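(* Let $(R,\mathfrak m,k)$ be a regular Noetherian local ring of dimension $2$ and let $\mathcal V$ be the partially ordered set of normalized proper valuations centered at $R$. Let $\tilde\mu$ and $\tilde\nu$ be two valuations in $\mathcal V$. Then there exists an infimum of $\tilde\mu$ and $\tilde\nu$ in the poset $\mathcal V$, that is, a greatest element of $\mathcal V$ among those that are less than or equal to both $\tilde\mu$ and $\tilde\nu$.
   Context: A valuation centered at $R$ is a function $\nu:R\to[0,\infty]=\mathbb R_{\ge0}\cup\{\infty\}$ such that $\nu(f+g)\ge\min(\nu(f),\nu(g))$ and $\nu(fg)=\nu(f)+\nu(g)$ for all $f,g\in R$, $\nu(0)=\infty$, $\nu(1)=0$, and $\nu(f)>0$ for all $f\in\mathfrak m$. Nonzero elements are allowed to have value $\infty$. The valuation is proper if $\nu$ is not identically $0$ on $R\setminus\{0\}$ and $\nu(\mathfrak m)\neq\{\infty\}$. It is normalized if $\inf\{\nu(f)\mid f\in\mathfrak m\}=1$. $\mathcal V$ denotes the set of normalized proper valuations centered at $R$ (each class of proper valuations modulo multiplication by positive real constants has exactly one normalized representative), partially ordered by: $\mu\le\nu$ if and only if $\mu(f)\le\nu(f)$ for all $f\in R$. *)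

theory Defs
  imports
    "HOL-Algebra.Ring_Divisibility"
    "HOL-Library.Extended_Nat"
    "HOL-Library.Extended_Nonnegative_Real"
begin

text \<open>A chain of prime ideals \<open>P 0 \<subset> \<dots> \<subset> P n\<close> has length \<open>n\<close>. For the zero ring the supremum is
  over the empty set, hence \<open>0\<close>; local rings are nonzero, so this value plays no role.\<close>

definition krull_dim :: "('a, 'b) ring_scheme \<Rightarrow> enat" where
  "krull_dim R = Sup {enat n | n. \<exists>P :: nat \<Rightarrow> 'a set.
     (\<forall>i\<le>n. primeideal (P i) R) \<and> (\<forall>i<n. P i \<subset> P (Suc i))}"

text \<open>The residue field is not a separate parameter: it is \<open>R Quot \<mm>\<close>.\<close>

locale local_ring = cring R for R (structure) and \<mm> +
  assumes maximal: "maximalideal \<mm> R"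
    and unique_maximal: "maximalideal J R \<Longrightarrow> J = \<mm>"

locale regular_local_ring = local_ring R \<mm> + noetherian_ring R for R (structure) and \<mm> +
  assumes regular: "\<exists>A \<subseteq> carrier R. finite A \<and> enat (card A) = krull_dim R \<and> \<mm> = Idl A"

text \<open>Valuations are functions on \<open>carrier R\<close>; extensionality fixes their values elsewhere, so that
  equality in HOL is equality as functions on \<open>R\<close>.\<close>

definition centered_valuation ::
    "('a, 'b) ring_scheme \<Rightarrow> 'a set \<Rightarrow> ('a \<Rightarrow> ennreal) \<Rightarrow> bool" where
  "centered_valuation R \<mm> \<nu> \<longleftrightarrow>
     \<nu> \<in> extensional (carrier R) \<and>
     (\<forall>f\<in>carrier R. \<forall>g\<in>carrier R. \<nu> (f \<oplus>\<^bsub>R\<^esub> g) \<ge> min (\<nu> f) (\<nu> g)) \<and>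
     (\<forall>f\<in>carrier R. \<forall>g\<in>carrier R. \<nu> (f \<otimes>\<^bsub>R\<^esub> g) = \<nu> f + \<nu> g) \<and>
     \<nu> \<zero>\<^bsub>R\<^esub> = \<infinity> \<and>
     \<nu> \<one>\<^bsub>R\<^esub> = 0 \<and>
     (\<forall>f\<in>\<mm>. \<nu> f > 0)"

definition proper_valuation ::
    "('a, 'b) ring_scheme \<Rightarrow> 'a set \<Rightarrow> ('a \<Rightarrow> ennreal) \<Rightarrow> bool" where
  "proper_valuation R \<mm> \<nu> \<longleftrightarrow>
     \<not> (\<forall>f\<in>carrier R - {\<zero>\<^bsub>R\<^esub>}. \<nu> f = 0) \<and> \<nu> ` \<mm> \<noteq> {\<infinity>}"

definition normalized_valuation :: "'a set \<Rightarrow> ('a \<Rightarrow> ennreal) \<Rightarrow> bool" where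
  "normalized_valuation \<mm> \<nu> \<longleftrightarrow> (INF f\<in>\<mm>. \<nu> f) = 1"

definition valuation_poset ::
    "('a, 'b) ring_scheme \<Rightarrow> 'a set \<Rightarrow> ('a \<Rightarrow> ennreal) gorder" where
  "valuation_poset R \<mm> =
     \<lparr> carrier = {\<nu>. centered_valuation R \<mm> \<nu> \<and> proper_valuation R \<mm> \<nu> \<and>
                     normalized_valuation \<mm> \<nu>},
       eq = (=),
       le = (\<lambda>\<mu> \<nu>. \<forall>f\<in>carrier R. \<mu> f \<le> \<nu> f) \<rparr>"

lemma partial_order_valuation_poset: "partial_order (valuation_poset R \<mm>)"
proof
  fix \<mu> \<nu>
  assume "\<mu> \<sqsubseteq>\<^bsub>valuation_poset R \<mm>\<^esub> \<nu>" "\<nu> \<sqsubseteq>\<^bsub>valuation_poset R \<mm>\<^esub> \<mu>"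
    "\<mu> \<in> carrier (valuation_poset R \<mm>)" "\<nu> \<in> carrier (valuation_poset R \<mm>)"
  then have "\<mu> \<in> extensional (carrier R)" "\<nu> \<in> extensional (carrier R)"
    and "\<And>f. f \<in> carrier R \<Longrightarrow> \<mu> f = \<nu> f"
    by (auto simp: valuation_poset_def centered_valuation_def intro: order.antisym)
  then have "\<mu> = \<nu>"
    by (rule extensionalityI)
  then show "\<mu> .=\<^bsub>valuation_poset R \<mm>\<^esub> \<nu>"
    by (simp add: valuation_poset_def)
qed (auto simp: valuation_poset_def intro: order.trans)

end

theory Submission
  imports Defs
begin

text \<open>The lower bounds of a fixed \<open>\<mu> \<in> \<V>\<close> form a chain, and the pointwise supremum of a nonempty chain
  of normalized valuations below \<open>\<mu>\<close> is again one. Hence the infimum of \<open>\<mu>\<close> and \<open>\<nu>\<close> is the supremum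
  of their common lower bounds, and there is at least one of these: the \<open>\<mm>\<close>-adic order, which is a
  valuation because \<open>R\<close> is regular.

  For the chain property write \<open>\<mm> = (x, y)\<close> with \<open>\<mu> x = 1\<close>; all normalized valuations below \<open>\<mu>\<close>
  then take the value \<open>1\<close> at \<open>x\<close>. The ideals \<open>(x, f)\<close> are linearly ordered, and the order of \<open>f\<close>
  modulo \<open>x\<close> replaces the degree in MacLane's theory of key polynomials: if \<open>\<kappa> < \<mu>\<close>, pick \<open>p\<close> with
  \<open>\<kappa> p < \<mu> p\<close> and \<open>(x, p)\<close> maximal. Every \<open>f\<close> is \<open>p Q + x\<^sup>j g\<close> with \<open>g \<notin> (x, p)\<close> or \<open>j\<close> as large as
  desired, and \<open>\<kappa> f = min (\<kappa> (p Q)) (\<kappa> (x\<^sup>j g))\<close> in the first case, where \<open>\<kappa> (x\<^sup>j g) = \<mu> (x\<^sup>j g)\<close>. So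
  \<open>\<kappa>\<close> is determined by \<open>\<mu>\<close>, \<open>p\<close> and \<open>\<kappa> p\<close>, and two lower bounds are compared through these data.\<close>

section \<open>Noetherian local rings\<close>

text \<open>A nonempty chain of ideals contains its own union here, so Zorn's lemma applies to an
  arbitrary nonempty family of ideals.\<close>

lemma (in noetherian_ring) exists_maximal_ideal_in:
  assumes "S \<noteq> {}" and "\<And>I. I \<in> S \<Longrightarrow> ideal I R"
  shows "\<exists>M\<in>S. \<forall>J\<in>S. M \<subseteq> J \<longrightarrow> J = M"
proof (rule subset_Zorn_nonempty[OF assms(1)])
  fix C assume "C \<noteq> {}" "subset.chain S C"
  moreover have "S \<subseteq> {I. ideal I R}" using assms(2) by blast
  ultimately have "\<Union>C \<in> C"
    by (intro ideal_chain_is_trivial) (auto simp: subset_chain_def)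
  then show "\<Union>C \<in> S"
    using \<open>subset.chain S C\<close> by (auto simp: subset_chain_def)
qed

section \<open>Subtraction and ideals with two generators\<close>

context cring
begin

lemma minus_eq_iff:
  assumes [simp]: "a \<in> carrier R" "b \<in> carrier R" "c \<in> carrier R"
  shows "a \<ominus> b = c \<longleftrightarrow> a = c \<oplus> b"
proof
  assume "a \<ominus> b = c"
  then have "c \<oplus> b = (a \<ominus> b) \<oplus> b" by simp
  then show "a = c \<oplus> b" by (simp add: a_minus_def a_assoc l_neg)
qed (simp add: a_minus_def a_assoc r_neg)

lemma r_distr_minus:
  "\<lbrakk>a \<in> carrier R; b \<in> carrier R; c \<in> carrier R\<rbrakk> \<Longrightarrow> a \<otimes> (b \<ominus> c) = a \<otimes> b \<ominus> a \<otimes> c"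
  by (simp add: a_minus_def r_distr r_minus)

lemma l_distr_minus:
  "\<lbrakk>a \<in> carrier R; b \<in> carrier R; c \<in> carrier R\<rbrakk> \<Longrightarrow> (b \<ominus> c) \<otimes> a = b \<otimes> a \<ominus> c \<otimes> a"
  by (simp add: a_minus_def l_distr l_minus)

lemma minus_eq_minus_if_add_eq:
  assumes eq: "a \<oplus> b = c \<oplus> d"
    and [simp]: "a \<in> carrier R" "b \<in> carrier R" "c \<in> carrier R" "d \<in> carrier R"
  shows "b \<ominus> d = c \<ominus> a"
proof -
  have "(c \<ominus> a) \<oplus> d = (c \<oplus> d) \<ominus> a" by (simp add: a_minus_def a_ac)
  also have "\<dots> = b" by (subst minus_eq_iff) (simp_all add: eq[symmetric] a_comm)
  finally show ?thesis by (subst minus_eq_iff) simp_all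
qed

text \<open>With \<open>a\<close> fixed, this ideal represents the principal ideal of
  \<open>b\<close> modulo \<open>a\<close>, so that divisibility in the quotient by \<open>a\<close>
  is handled inside \<open>R\<close>.\<close>

definition pair_ideal :: "'a \<Rightarrow> 'a \<Rightarrow> 'a set" where
  "pair_ideal a b = {a \<otimes> s \<oplus> b \<otimes> t | s t. s \<in> carrier R \<and> t \<in> carrier R}"

lemma pair_idealI:
  "\<lbrakk>f = a \<otimes> s \<oplus> b \<otimes> t; s \<in> carrier R; t \<in> carrier R\<rbrakk> \<Longrightarrow> f \<in> pair_ideal a b"
  by (auto simp: pair_ideal_def)

lemma pair_idealE:
  assumes "f \<in> pair_ideal a b"
  obtains s t where "s \<in> carrier R" "t \<in> carrier R" "f = a \<otimes> s \<oplus> b \<otimes> t"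
  using assms by (auto simp: pair_ideal_def)

lemma ideal_pair_ideal:
  assumes [simp]: "a \<in> carrier R" "b \<in> carrier R"
  shows "ideal (pair_ideal a b) R"
proof (rule idealI[OF ring_axioms])
  show "subgroup (pair_ideal a b) (add_monoid R)"
  proof (rule add.subgroupI)
    show "pair_ideal a b \<subseteq> carrier R" by (auto elim!: pair_idealE)
    have "\<zero> \<in> pair_ideal a b" by (rule pair_idealI[of _ _ \<zero> _ \<zero>]) auto
    then show "pair_ideal a b \<noteq> {}" by blast
  next
    fix f assume "f \<in> pair_ideal a b"
    then obtain s t where [simp]: "s \<in> carrier R" "t \<in> carrier R" and f: "f = a \<otimes> s \<oplus> b \<otimes> t"
      by (rule pair_idealE)
    show "\<ominus> f \<in> pair_ideal a b"
      by (rule pair_idealI[of _ _ "\<ominus> s" _ "\<ominus> t"]) (auto simp: f r_minus minus_add)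
  next
    fix f g assume "f \<in> pair_ideal a b" "g \<in> pair_ideal a b"
    then obtain s t s' t' where [simp]: "s \<in> carrier R" "t \<in> carrier R" "s' \<in> carrier R" "t' \<in> carrier R"
      and f: "f = a \<otimes> s \<oplus> b \<otimes> t" "g = a \<otimes> s' \<oplus> b \<otimes> t'"
      by (elim pair_idealE) blast
    show "f \<oplus> g \<in> pair_ideal a b"
      by (rule pair_idealI[of _ _ "s \<oplus> s'" _ "t \<oplus> t'"]) (auto simp: f r_distr a_ac)
  qed
next
  fix f r assume "f \<in> pair_ideal a b" and [simp]: "r \<in> carrier R"
  then obtain s t where [simp]: "s \<in> carrier R" "t \<in> carrier R" and f: "f = a \<otimes> s \<oplus> b \<otimes> t"
    by (elim pair_idealE)
  have "r \<otimes> f = a \<otimes> (r \<otimes> s) \<oplus> b \<otimes> (r \<otimes> t)"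
    by (simp add: f r_distr m_ac)
  then show "r \<otimes> f \<in> pair_ideal a b" by (rule pair_idealI) auto
  then show "f \<otimes> r \<in> pair_ideal a b" by (simp add: m_comm f)
qed

lemma genideal_pair:
  assumes [simp]: "a \<in> carrier R" "b \<in> carrier R"
  shows "Idl {a, b} = pair_ideal a b"
proof
  have "a \<in> pair_ideal a b" by (rule pair_idealI[of _ _ \<one> _ \<zero>]) auto
  moreover have "b \<in> pair_ideal a b" by (rule pair_idealI[of _ _ \<zero> _ \<one>]) auto
  ultimately show "Idl {a, b} \<subseteq> pair_ideal a b"
    by (intro genideal_minimal ideal_pair_ideal) auto
  interpret I: ideal "Idl {a, b}" R by (rule genideal_ideal) simp
  have "a \<in> Idl {a, b}" "b \<in> Idl {a, b}" using genideal_self[of "{a, b}"] by auto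
  then show "pair_ideal a b \<subseteq> Idl {a, b}"
    by (auto elim!: pair_idealE intro!: I.a_closed I.I_r_closed)
qed

lemma in_pair_ideal_right: "\<lbrakk>a \<in> carrier R; b \<in> carrier R\<rbrakk> \<Longrightarrow> b \<in> pair_ideal a b"
  by (rule pair_idealI[of _ _ \<zero> _ \<one>]) auto

lemma pair_ideal_subset_iff:
  assumes [simp]: "a \<in> carrier R" "b \<in> carrier R" "c \<in> carrier R"
  shows "pair_ideal a b \<subseteq> pair_ideal a c \<longleftrightarrow> b \<in> pair_ideal a c"
proof
  assume "b \<in> pair_ideal a c"
  moreover have "a \<in> pair_ideal a c"
    by (rule pair_idealI[of _ _ \<one> _ \<zero>]) auto
  ultimately show "pair_ideal a b \<subseteq> pair_ideal a c"
    using genideal_minimal[OF ideal_pair_ideal[of a c], of "{a, b}"] by (simp add: genideal_pair)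
qed (use in_pair_ideal_right in auto)

end

section \<open>Units and Nakayama's lemma in Noetherian local rings\<close>

locale noetherian_local_ring = local_ring R \<mm> + noetherian_ring R for R (structure) and \<mm>
begin

sublocale \<mm>: maximalideal \<mm> R by (rule maximal)

text \<open>A non-unit generates a proper ideal. A maximal member among the proper ideals containing
  it is a maximal ideal, hence equal to \<open>\<mm>\<close>.\<close>

lemma not_mem_maximal_imp_Units:
  assumes f: "f \<in> carrier R" "f \<notin> \<mm>"
  shows "f \<in> Units R"
proof (rule ccontr)
  assume nu: "f \<notin> Units R"
  let ?S = "{I. ideal I R \<and> PIdl f \<subseteq> I \<and> I \<noteq> carrier R}"
  have "PIdl f \<noteq> carrier R"
  proof
    assume "PIdl f = carrier R"
    then have "\<one> \<in> PIdl f" by simp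
    then show False using nu f by (auto simp: cgenideal_def Units_def m_comm)
  qed
  then have "?S \<noteq> {}" using cgenideal_ideal[OF f(1)] by auto
  from exists_maximal_ideal_in[OF this]
  obtain M where M: "ideal M R" "PIdl f \<subseteq> M" "M \<noteq> carrier R"
    and max: "\<And>J. \<lbrakk>ideal J R; PIdl f \<subseteq> J; J \<noteq> carrier R; M \<subseteq> J\<rbrakk> \<Longrightarrow> J = M"
    by (smt (verit, best) mem_Collect_eq)
  have "maximalideal M R"
    using M max by (intro maximalidealI) (blast dest: order.trans)+
  then have "M = \<mm>" by (rule unique_maximal)
  then show False using M(2) f cgenideal_self by blast
qed

lemma one_not_mem_maximal: "\<one> \<notin> \<mm>"
  using \<mm>.one_imp_carrier \<mm>.I_notcarr by blast

lemma Units_not_mem_maximal: "u \<in> Units R \<Longrightarrow> u \<notin> \<mm>"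
  using one_not_mem_maximal \<mm>.I_r_closed[of u "inv u"] by (auto simp: Units_r_inv)

lemma proper_ideal_subset_maximal:
  assumes "ideal I R" "I \<noteq> carrier R"
  shows "I \<subseteq> \<mm>"
proof
  interpret ideal I R by fact
  fix f assume "f \<in> I"
  have "f \<notin> Units R"
  proof
    assume "f \<in> Units R"
    then have "\<one> \<in> I" using I_r_closed[OF \<open>f \<in> I\<close>, of "inv f"] by auto
    then show False using one_imp_carrier assms(2) by blast
  qed
  then show "f \<in> \<mm>" using not_mem_maximal_imp_Units \<open>f \<in> I\<close> a_Hcarr by blast
qed

lemma Units_minus_maximal:
  assumes u: "u \<in> Units R" and z: "z \<in> \<mm>"
  shows "u \<ominus> z \<in> Units R"
proof (rule not_mem_maximal_imp_Units)
  have [simp]: "z \<in> carrier R" "u \<in> carrier R" using u z by auto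
  show "u \<ominus> z \<in> carrier R" by simp
  have "(u \<ominus> z) \<oplus> z = u" by (simp add: a_minus_def a_assoc l_neg)
  then show "u \<ominus> z \<notin> \<mm>"
    using \<mm>.a_closed[OF _ z, of "u \<ominus> z"] Units_not_mem_maximal[OF u] by auto
qed

lemma divides_Units_mult_cancel:
  assumes u: "u \<in> Units R" and f: "f \<in> carrier R" and "a \<in> carrier R" "a divides u \<otimes> f"
  shows "a divides f"
proof -
  obtain c where c: "c \<in> carrier R" "u \<otimes> f = a \<otimes> c"
    using assms(4) by (auto simp: factor_def)
  have "f = inv u \<otimes> (u \<otimes> f)"
    using u f Units_closed[OF u] by (simp add: m_assoc[symmetric])
  also have "\<dots> = a \<otimes> (inv u \<otimes> c)"
    unfolding c(2) using u c(1) assms(3) by (simp add: m_lcomm)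
  finally show ?thesis using u c(1) by (auto simp: factor_def)
qed

text \<open>The Noetherian property for the ideals \<open>(a, f)\<close> with \<open>f\<close> in
  \<open>T\<close>. Maximality of \<open>(a, p)\<close> is expressed through membership of the
  second generators, the form that fits uniseriality modulo \<open>x\<close>.\<close>

lemma exists_maximal_modulo:
  assumes "T \<noteq> {}" "T \<subseteq> carrier R" and a: "a \<in> carrier R"
  obtains p where "p \<in> T" "\<And>f. \<lbrakk>f \<in> T; p \<in> pair_ideal a f\<rbrakk> \<Longrightarrow> f \<in> pair_ideal a p"
proof -
  have "\<exists>M\<in>pair_ideal a ` T. \<forall>J\<in>pair_ideal a ` T. M \<subseteq> J \<longrightarrow> J = M"
    using assms by (intro exists_maximal_ideal_in) (auto intro!: ideal_pair_ideal)
  then obtain p where p: "p \<in> T"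
    "\<And>f. f \<in> T \<Longrightarrow> pair_ideal a p \<subseteq> pair_ideal a f \<Longrightarrow> pair_ideal a f = pair_ideal a p"
    by auto
  show ?thesis
  proof (rule that[OF p(1)])
    fix f assume "f \<in> T" "p \<in> pair_ideal a f"
    then have "f \<in> carrier R" "p \<in> carrier R" using p(1) assms(2) by auto
    then have "pair_ideal a p \<subseteq> pair_ideal a f"
      using \<open>p \<in> pair_ideal a f\<close> a by (simp add: pair_ideal_subset_iff)
    then have "pair_ideal a f = pair_ideal a p" using p(2) \<open>f \<in> T\<close> by simp
    then show "f \<in> pair_ideal a p" using in_pair_ideal_right[OF a \<open>f \<in> carrier R\<close>] by simp
  qed
qed

text \<open>If \<open>T\<close> is an ideal, this is Nakayama's lemma for \<open>T\<close> modulo \<open>a\<close>: an \<open>f \<in> T\<close> not divisible by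
  \<open>a\<close> with \<open>(a, f)\<close> maximal cannot lie in \<open>\<mm>T + (a)\<close>.\<close>
lemma nakayama_divides:
  assumes T: "T \<subseteq> carrier R" and a: "a \<in> carrier R"
    and step: "\<And>f. \<lbrakk>f \<in> T; \<not> a divides f\<rbrakk> \<Longrightarrow>
      \<exists>z\<in>\<mm>. \<exists>g\<in>T. \<exists>s\<in>carrier R. f = z \<otimes> g \<oplus> a \<otimes> s"
    and "f \<in> T"
  shows "a divides f"
proof (rule ccontr)
  assume "\<not> a divides f"
  let ?T = "{f \<in> T. \<not> a divides f}"
  have "?T \<noteq> {}" "?T \<subseteq> carrier R" using T \<open>f \<in> T\<close> \<open>\<not> a divides f\<close> by auto
  from exists_maximal_modulo[OF this a] obtain p
    where p: "p \<in> T" "\<not> a divides p"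
      and max: "\<And>f. \<lbrakk>f \<in> T; \<not> a divides f; p \<in> pair_ideal a f\<rbrakk> \<Longrightarrow> f \<in> pair_ideal a p"
    by (metis (mono_tags, lifting) mem_Collect_eq)
  from step[OF p] obtain z g s where zgs: "z \<in> \<mm>" "g \<in> T" "s \<in> carrier R"
    and p_eq: "p = z \<otimes> g \<oplus> a \<otimes> s" by blast
  have [simp]: "z \<in> carrier R" "g \<in> carrier R" "s \<in> carrier R" "a \<in> carrier R"
    using zgs T a \<mm>.a_Hcarr by auto
  have ndvd: "\<not> a divides g"
  proof
    assume "a divides g"
    then obtain c where [simp]: "c \<in> carrier R" and g: "g = a \<otimes> c" by (auto simp: factor_def)
    have "p = a \<otimes> (z \<otimes> c \<oplus> s)" unfolding p_eq g by (simp add: r_distr m_ac)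
    then show False using p(2) by (auto simp: factor_def)
  qed
  \<comment> \<open>Maximality now puts \<open>g\<close> into \<open>(a, p)\<close>. Substituting
    \<open>p = z g + a s\<close> into \<open>g = a t + p w\<close> shows that \<open>a\<close>
    divides \<open>(1 - z w) g\<close>, and \<open>1 - z w\<close> is a unit.\<close>
  have "p \<in> pair_ideal a g"
    by (rule pair_idealI[of _ _ s _ z]) (auto simp: p_eq m_comm a_comm)
  from max[OF zgs(2) ndvd this] obtain t w where [simp]: "t \<in> carrier R" "w \<in> carrier R"
    and g: "g = a \<otimes> t \<oplus> p \<otimes> w" by (rule pair_idealE)
  have "g = a \<otimes> t \<oplus> (z \<otimes> g \<oplus> a \<otimes> s) \<otimes> w" using g p_eq by simp
  also have "\<dots> = a \<otimes> (t \<oplus> s \<otimes> w) \<oplus> z \<otimes> w \<otimes> g" by (simp add: r_distr l_distr m_ac a_ac)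
  finally have "(\<one> \<ominus> z \<otimes> w) \<otimes> g = a \<otimes> (t \<oplus> s \<otimes> w)"
    by (simp add: l_distr_minus minus_eq_iff)
  then have "a divides (\<one> \<ominus> z \<otimes> w) \<otimes> g" by (auto simp: factor_def)
  then have "a divides g"
    by (rule divides_Units_mult_cancel[rotated 3])
      (auto intro!: Units_minus_maximal \<mm>.I_r_closed zgs(1))
  with ndvd show False ..
qed

end

section \<open>Local rings with a maximal ideal generated by two elements\<close>

locale two_generated_local_ring = noetherian_local_ring +
  fixes x y
  assumes x_closed [simp]: "x \<in> carrier R" and y_closed [simp]: "y \<in> carrier R"
    and maximal_eq: "\<mm> = Idl {x, y}"
begin

lemma maximal_eq_pair_ideal: "\<mm> = pair_ideal x y"
  by (simp add: maximal_eq genideal_pair)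

lemma x_mem: "x \<in> \<mm>"
  unfolding maximal_eq_pair_ideal by (rule pair_idealI[of _ _ \<one> _ \<zero>]) auto

lemma y_mem: "y \<in> \<mm>"
  unfolding maximal_eq_pair_ideal by (rule in_pair_ideal_right) auto

text \<open>Take the largest \<open>k\<close> with \<open>f\<close> in \<open>(x, y^k)\<close>. The
  cofactor of \<open>y^k\<close> is a unit, because a cofactor in \<open>\<mm> = (x, y)\<close>
  would provide another factor \<open>y\<close> modulo \<open>x\<close>.\<close>

lemma residue_unit_times_power:
  assumes f: "f \<in> carrier R" and "f \<notin> pair_ideal x (y [^] (n::nat))"
  obtains a k u where "a \<in> carrier R" "u \<in> Units R" "f = x \<otimes> a \<oplus> y [^] (k::nat) \<otimes> u"
proof -
  have "\<exists>k. f \<in> pair_ideal x (y [^] k) \<and> f \<notin> pair_ideal x (y [^] Suc k)"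
  proof (rule ccontr)
    assume "\<not> ?thesis"
    moreover have "f \<in> pair_ideal x (y [^] (0::nat))"
      by (rule pair_idealI[of _ _ \<zero> _ f]) (use f in auto)
    ultimately have "f \<in> pair_ideal x (y [^] n)" by (induction n) blast+
    with assms(2) show False ..
  qed
  then obtain k where k: "f \<in> pair_ideal x (y [^] k)" "f \<notin> pair_ideal x (y [^] Suc k)"
    by blast
  from k(1) obtain a b where [simp]: "a \<in> carrier R" "b \<in> carrier R"
    and f_eq: "f = x \<otimes> a \<oplus> y [^] k \<otimes> b" by (rule pair_idealE)
  have "b \<notin> \<mm>"
  proof
    assume "b \<in> \<mm>"
    then obtain s t where [simp]: "s \<in> carrier R" "t \<in> carrier R" and b: "b = x \<otimes> s \<oplus> y \<otimes> t"
      unfolding maximal_eq_pair_ideal by (rule pair_idealE)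
    define q where "q = y [^] k"
    have [simp]: "q \<in> carrier R" by (simp add: q_def)
    have "f = x \<otimes> (a \<oplus> q \<otimes> s) \<oplus> (q \<otimes> y) \<otimes> t"
      unfolding f_eq b q_def[symmetric] by (simp add: r_distr l_distr m_ac a_ac)
    then show False using k(2) by (auto simp: q_def intro: pair_idealI)
  qed
  then show ?thesis
    using that[OF \<open>a \<in> carrier R\<close> _ f_eq] not_mem_maximal_imp_Units by simp
qed

text \<open>Krull's intersection theorem modulo \<open>x\<close>, where \<open>\<mm>\<close> is
  generated by \<open>y\<close>. The set \<open>T\<close> of all such \<open>f\<close> satisfies
  \<open>T \<subseteq> y T + (x)\<close>, so Nakayama's lemma applies.\<close>

lemma divides_if_mem_all_powers:
  assumes "f \<in> carrier R" "\<And>n::nat. f \<in> pair_ideal x (y [^] n)"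
  shows "x divides f"
proof -
  let ?T = "{f \<in> carrier R. \<forall>n::nat. f \<in> pair_ideal x (y [^] n)}"
  show ?thesis
  proof (rule nakayama_divides[of ?T])
    fix f assume "f \<in> ?T" and ndvd: "\<not> x divides f"
    then have [simp]: "f \<in> carrier R" and all: "\<And>n::nat. f \<in> pair_ideal x (y [^] n)" by auto
    from all[of 1] obtain s w where [simp]: "s \<in> carrier R" "w \<in> carrier R"
      and f: "f = x \<otimes> s \<oplus> y \<otimes> w" by (auto elim: pair_idealE)
    \<comment> \<open>Otherwise \<open>w\<close> is \<open>y^k u\<close> modulo \<open>x\<close>
      with a unit \<open>u\<close>, and \<open>f\<close> is \<open>y^(k+1) u\<close>. As
      \<open>f\<close> also lies in \<open>(x, y^(k+2))\<close>, \<open>x\<close> divides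
      \<open>y^(k+1)\<close> and therefore \<open>f\<close>.\<close>
    have "w \<in> ?T"
    proof (rule ccontr)
      assume "w \<notin> ?T"
      then obtain n where "w \<notin> pair_ideal x (y [^] (n::nat))" by auto
      then obtain a k u where [simp]: "a \<in> carrier R" and u: "u \<in> Units R"
        and w: "w = x \<otimes> a \<oplus> y [^] (k::nat) \<otimes> u"
        using residue_unit_times_power[of w n] by (metis \<open>w \<in> carrier R\<close>)
      note [simp] = Units_closed[OF u]
      define q where "q = y [^] Suc k"
      have [simp]: "q \<in> carrier R" by (simp add: q_def)
        have "y [^] k \<otimes> y = q" by (simp add: q_def)
      then have f1: "f = x \<otimes> (s \<oplus> y \<otimes> a) \<oplus> q \<otimes> u"
        unfolding f w by (simp add: r_distr m_ac a_ac)
      from all[of "Suc (Suc k)"] obtain s' t' where [simp]: "s' \<in> carrier R" "t' \<in> carrier R"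
        and f2: "f = x \<otimes> s' \<oplus> (q \<otimes> y) \<otimes> t'" unfolding q_def by (auto elim: pair_idealE)
      have "q \<otimes> u \<ominus> (q \<otimes> y) \<otimes> t' = x \<otimes> s' \<ominus> x \<otimes> (s \<oplus> y \<otimes> a)"
        using f1 f2 by (intro minus_eq_minus_if_add_eq) auto
      then have "(u \<ominus> y \<otimes> t') \<otimes> q = x \<otimes> (s' \<ominus> (s \<oplus> y \<otimes> a))"
        by (simp add: l_distr_minus r_distr_minus m_ac)
      then have "x divides (u \<ominus> y \<otimes> t') \<otimes> q" by (auto simp: factor_def)
      then have "x divides q"
        by (rule divides_Units_mult_cancel[rotated 3])
          (auto intro!: Units_minus_maximal[OF u] \<mm>.I_r_closed y_mem)
      then obtain c where "c \<in> carrier R" "q = x \<otimes> c" by (auto simp: factor_def)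
      then have "f = x \<otimes> ((s \<oplus> y \<otimes> a) \<oplus> c \<otimes> u)"
        unfolding f1 by (simp add: r_distr m_assoc)
      then show False using ndvd \<open>c \<in> carrier R\<close> by (auto simp: factor_def)
    qed
    moreover have "f = y \<otimes> w \<oplus> x \<otimes> s" by (simp add: f a_comm)
    ultimately show "\<exists>z\<in>\<mm>. \<exists>g\<in>?T. \<exists>s\<in>carrier R. f = z \<otimes> g \<oplus> x \<otimes> s"
      using y_mem \<open>s \<in> carrier R\<close> by blast
  qed (use assms in auto)
qed

lemma not_divides_residue:
  assumes "f \<in> carrier R" "\<not> x divides f"
  obtains a k u where "a \<in> carrier R" "u \<in> Units R" "f = x \<otimes> a \<oplus> y [^] (k::nat) \<otimes> u"
  using divides_if_mem_all_powers[OF assms(1)] residue_unit_times_power[OF assms(1)] assms(2)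
  by metis

text \<open>Modulo \<open>x\<close> every element is zero or a unit times a power of
  \<open>y\<close>, so of two elements the one with the smaller exponent divides the other.\<close>

lemma uniserial_modulo:
  assumes [simp]: "f \<in> carrier R" "g \<in> carrier R"
  shows "f \<in> pair_ideal x g \<or> g \<in> pair_ideal x f"
proof -
  have div: "f \<in> pair_ideal x g" if dvd: "x divides f" and [simp]: "f \<in> carrier R" "g \<in> carrier R" for f g
  proof -
    obtain c where "c \<in> carrier R" "f = x \<otimes> c" using dvd unfolding factor_def by blast
    then have "f = x \<otimes> c \<oplus> g \<otimes> \<zero>" by simp
    then show ?thesis by (rule pair_idealI) (simp_all add: \<open>c \<in> carrier R\<close>)
  qed
  have le: "f \<in> pair_ideal x g"
    if [simp]: "a \<in> carrier R" "b \<in> carrier R" and u: "u \<in> Units R" and v: "v \<in> Units R"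
      and f: "f = x \<otimes> a \<oplus> y [^] k \<otimes> u" and g: "g = x \<otimes> b \<oplus> y [^] l \<otimes> v" and "l \<le> k"
    for f g a b u v and k l :: nat
  proof -
    note [simp] = Units_closed[OF u] Units_closed[OF v] Units_inv_closed[OF v]
    define p q i where "p = y [^] l" and "q = y [^] (k - l)" and "i = inv v"
    have [simp]: "p \<in> carrier R" "q \<in> carrier R" "i \<in> carrier R" by (auto simp: p_def q_def i_def)
    have pq: "y [^] k = p \<otimes> q" using \<open>l \<le> k\<close> by (simp add: p_def q_def nat_pow_mult)
    \<comment> \<open>The factor \<open>i q u\<close> is the quotient of \<open>y^k u\<close> by
      \<open>y^l v\<close>. The multiple of \<open>x\<close> that it creates is subtracted from
      \<open>x a\<close> afterwards.\<close>
    have "g \<otimes> (i \<otimes> q \<otimes> u) = x \<otimes> (b \<otimes> i \<otimes> q \<otimes> u) \<oplus> p \<otimes> q \<otimes> u \<otimes> (v \<otimes> i)"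
      unfolding g p_def[symmetric] by (simp add: l_distr r_distr m_ac)
    then have "x \<otimes> (a \<ominus> b \<otimes> i \<otimes> q \<otimes> u) \<oplus> g \<otimes> (i \<otimes> q \<otimes> u)
        = x \<otimes> a \<oplus> p \<otimes> q \<otimes> u \<otimes> (v \<otimes> i)"
      by (simp add: a_minus_def r_distr r_minus a_assoc r_neg1)
    also have "\<dots> = f" using v by (simp add: f pq i_def)
    finally show ?thesis by (intro pair_idealI) auto
  qed
  show ?thesis
  proof (cases "x divides f \<or> x divides g")
    case True then show ?thesis using div by auto
  next
    case False
    then obtain a k u b l v where
      "a \<in> carrier R" "u \<in> Units R" "f = x \<otimes> a \<oplus> y [^] (k::nat) \<otimes> u"
      "b \<in> carrier R" "v \<in> Units R" "g = x \<otimes> b \<oplus> y [^] (l::nat) \<otimes> v"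
      using not_divides_residue[of f] not_divides_residue[of g] by (metis assms)
    then show ?thesis using le[of a b u v f k g l] le[of b a v u g l f k] by linarith
  qed
qed

text \<open>Choose \<open>g\<close> in \<open>P\<close> with \<open>(x, g)\<close> maximal. By
  uniseriality each \<open>f\<close> in \<open>P\<close> is \<open>x s + g t\<close>, and
  \<open>x s\<close> in \<open>P\<close> forces \<open>s\<close> in \<open>P\<close> since
  \<open>x\<close> is not in \<open>P\<close>. Thus \<open>P = x P + (g)\<close>, and Nakayama's
  lemma modulo \<open>g\<close> gives \<open>P = (g)\<close>.\<close>

lemma primeideal_principal:
  assumes P: "primeideal P R" and "x \<notin> P"
  obtains g where "g \<in> P" "\<And>f. f \<in> P \<Longrightarrow> g divides f"
proof -
  interpret P: primeideal P R by fact
  have ne: "P \<noteq> {}" and carr: "P \<subseteq> carrier R" using P.zero_closed P.a_subset by blast+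
  obtain g where "g \<in> P" and max: "\<And>f. \<lbrakk>f \<in> P; g \<in> pair_ideal x f\<rbrakk> \<Longrightarrow> f \<in> pair_ideal x g"
    using exists_maximal_modulo[OF ne carr x_closed] by blast
  then have [simp]: "g \<in> carrier R" using carr by blast
  have "g divides f" if "f \<in> P" for f
  proof (rule nakayama_divides[OF carr _ _ that])
    fix f assume "f \<in> P"
    then have "f \<in> pair_ideal x g" using max uniserial_modulo[of f g] carr by auto
    then obtain s t where [simp]: "s \<in> carrier R" "t \<in> carrier R" and f: "f = x \<otimes> s \<oplus> g \<otimes> t"
      by (rule pair_idealE)
    have "x \<otimes> s = f \<ominus> g \<otimes> t" unfolding f by (simp add: a_minus_def a_assoc r_neg)
    also have "\<dots> \<in> P"
      using \<open>f \<in> P\<close> \<open>g \<in> P\<close> by (auto simp: a_minus_def intro!: P.a_closed P.a_inv_closed P.I_r_closed)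
    finally have "s \<in> P" using P.I_prime[of x s] \<open>x \<notin> P\<close> by auto
    then show "\<exists>z\<in>\<mm>. \<exists>h\<in>P. \<exists>s\<in>carrier R. f = z \<otimes> h \<oplus> g \<otimes> s"
      using f x_mem \<open>t \<in> carrier R\<close> by blast
  qed simp
  then show ?thesis using that \<open>g \<in> P\<close> by blast
qed

lemma pair_ideal_power:
  assumes "g \<in> pair_ideal x y"
  shows "g [^] (n::nat) \<in> pair_ideal x (y [^] n)"
proof (induction n)
  case 0
  show ?case by (simp add: in_pair_ideal_right)
next
  case (Suc n)
  then obtain s t where [simp]: "s \<in> carrier R" "t \<in> carrier R"
    and g: "g [^] n = x \<otimes> s \<oplus> y [^] n \<otimes> t" by (rule pair_idealE)
  from assms obtain s' t' where [simp]: "s' \<in> carrier R" "t' \<in> carrier R"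
    and g': "g = x \<otimes> s' \<oplus> y \<otimes> t'" by (rule pair_idealE)
  define q where "q = y [^] n"
  have [simp]: "q \<in> carrier R" by (simp add: q_def)
  have "g [^] Suc n = (x \<otimes> s \<oplus> q \<otimes> t) \<otimes> (x \<otimes> s' \<oplus> y \<otimes> t')"
    using g g' q_def by simp
  also have "\<dots> = x \<otimes> (s \<otimes> (x \<otimes> s' \<oplus> y \<otimes> t') \<oplus> q \<otimes> t \<otimes> s') \<oplus> (q \<otimes> y) \<otimes> (t \<otimes> t')"
    by (simp add: r_distr l_distr m_ac a_ac)
  finally show ?case by (intro pair_idealI) (auto simp: q_def)
qed

text \<open>Both primes are principal, and \<open>P\<^sub>0 = (p)\<close> is properly contained in \<open>P\<^sub>1 = (g)\<close>, so that
  \<open>p = g p b\<close> for some \<open>b\<close> and hence \<open>p = 0\<close>. If \<open>x\<close> divided a power of \<open>y\<close>, it would divide a power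
  of \<open>g\<close>, which is impossible as \<open>x\<close> is a non-unit outside the prime \<open>(g)\<close>.\<close>
lemma regular_sequence_if_prime_chain:
  assumes P0: "primeideal P0 R" and P1: "primeideal P1 R" and "P0 \<subset> P1" "x \<notin> P1"
  shows "domain R" and "\<not> x divides y [^] (n::nat)"
proof -
  interpret P0: primeideal P0 R by fact
  interpret P1: primeideal P1 R by fact
  from primeideal_principal[OF P0] obtain p where p: "p \<in> P0" "\<And>f. f \<in> P0 \<Longrightarrow> p divides f"
    using assms by blast
  from primeideal_principal[OF P1] obtain g where g: "g \<in> P1" "\<And>f. f \<in> P1 \<Longrightarrow> g divides f"
    using assms by blast
  have [simp]: "p \<in> carrier R" "g \<in> carrier R" using p(1) g(1) P0.a_Hcarr P1.a_Hcarr by auto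
  have sub: "P1 \<subseteq> \<mm>" by (rule proper_ideal_subset_maximal[OF P1.is_ideal]) (use P1.I_notcarr in auto)
  have gP0: "g \<notin> P0"
    using g(2) assms(3) P0.I_r_closed[of g] unfolding factor_def by blast
  obtain a where [simp]: "a \<in> carrier R" and pa: "p = g \<otimes> a"
    using g(2)[of p] p(1) assms(3) by (auto simp: factor_def)
  then have "a \<in> P0" using P0.I_prime[of g a] gP0 p(1) by auto
  then obtain b where [simp]: "b \<in> carrier R" and ab: "a = p \<otimes> b"
    using p(2) by (auto simp: factor_def)
  have u: "\<one> \<ominus> g \<otimes> b \<in> Units R"
    by (rule Units_minus_maximal) (use sub g(1) in \<open>auto intro: \<mm>.I_r_closed\<close>)
  have "(\<one> \<ominus> g \<otimes> b) \<otimes> p = p \<ominus> g \<otimes> (p \<otimes> b)"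
    by (simp add: l_distr_minus r_distr_minus m_ac)
  also have "\<dots> = \<zero>" unfolding ab[symmetric] pa[symmetric] by (simp add: r_right_minus_eq)
  finally have "\<zero> divides (\<one> \<ominus> g \<otimes> b) \<otimes> p" by (auto simp: factor_def)
  then have "\<zero> divides p" using divides_Units_mult_cancel[OF u] by auto
  then have "p = \<zero>" by (auto simp: factor_def)
  then have P0_eq: "P0 = {\<zero>}" using p(2) P0.zero_closed by (auto simp: factor_def)
  show dom: "domain R"
  proof (rule domain.intro[OF is_cring], unfold_locales)
    show "\<one> \<noteq> \<zero>" using one_not_mem_maximal \<mm>.zero_closed by auto
    show "a = \<zero> \<or> b = \<zero>" if "a \<otimes> b = \<zero>" "a \<in> carrier R" "b \<in> carrier R" for a b
      using P0.I_prime[of a b] that P0_eq by auto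
  qed
  interpret domain R by (rule dom)
  have "g \<noteq> \<zero>" using gP0 P0_eq by auto
  \<comment> \<open>If \<open>x c\<close> is a positive power of \<open>g\<close>, then
    \<open>c\<close> lies in \<open>P1 = (g)\<close> and one factor \<open>g\<close> cancels. The
    descent ends at \<open>x c = 1\<close>.\<close>
  have no: "x \<otimes> c \<noteq> g [^] n" if "c \<in> carrier R" for c and n :: nat
    using that
  proof (induction n arbitrary: c)
    case 0
    then have "x \<otimes> c \<in> \<mm>" using x_mem by (auto intro: \<mm>.I_r_closed)
    then show ?case using one_not_mem_maximal by auto
  next
    case (Suc n)
    show ?case
    proof
      assume eq: "x \<otimes> c = g [^] Suc n"
      then have "x \<otimes> c \<in> P1" using g(1) by (auto intro: P1.I_l_closed)
      then have "c \<in> P1" using P1.I_prime[of x c] Suc.prems assms(4) by auto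
      then obtain d where d: "d \<in> carrier R" "c = g \<otimes> d" using g(2) by (auto simp: factor_def)
      have "g \<otimes> (x \<otimes> d) = g \<otimes> g [^] n"
        using eq d by (simp add: m_lcomm m_comm)
      then have "x \<otimes> d = g [^] n" using \<open>g \<noteq> \<zero>\<close> d(1) by (simp add: m_lcancel)
      then show False using Suc.IH[OF d(1)] by simp
    qed
  qed
  show "\<not> x divides y [^] n"
  proof
    assume "x divides y [^] n"
    then obtain c where [simp]: "c \<in> carrier R" and c: "y [^] n = x \<otimes> c" by (auto simp: factor_def)
    have "g \<in> pair_ideal x y" using g(1) sub maximal_eq_pair_ideal by auto
    \<comment> \<open>\<open>g^n\<close> lies in \<open>(x, y^n)\<close>, which is
      \<open>(x)\<close> once \<open>x\<close> divides \<open>y^n\<close>.\<close>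
    from pair_ideal_power[OF this, of n] obtain s t where [simp]: "s \<in> carrier R" "t \<in> carrier R"
      and "g [^] n = x \<otimes> s \<oplus> x \<otimes> c \<otimes> t" unfolding c by (rule pair_idealE)
    then have "x \<otimes> (s \<oplus> c \<otimes> t) = g [^] n" by (simp add: r_distr m_assoc)
    then show False using no[of "s \<oplus> c \<otimes> t" n] by simp
  qed
qed

end

section \<open>Powers of the maximal ideal\<close>

context two_generated_local_ring
begin

text \<open>The powers of \<open>\<mm>\<close>. Building the next power from the two generators
  replaces products of ideals and makes induction on the exponent available.\<close>

primrec max_power :: "nat \<Rightarrow> 'a set" where
  "max_power 0 = carrier R"
| "max_power (Suc n) = {x \<otimes> a \<oplus> y \<otimes> b | a b. a \<in> max_power n \<and> b \<in> max_power n}"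

declare max_power.simps(2) [simp del]

lemma max_power_SucI:
  "\<lbrakk>f = x \<otimes> a \<oplus> y \<otimes> b; a \<in> max_power n; b \<in> max_power n\<rbrakk> \<Longrightarrow> f \<in> max_power (Suc n)"
  by (auto simp: max_power.simps(2))

lemma max_power_SucE:
  assumes "f \<in> max_power (Suc n)"
  obtains a b where "a \<in> max_power n" "b \<in> max_power n" "f = x \<otimes> a \<oplus> y \<otimes> b"
  using assms by (auto simp: max_power.simps(2))

lemma max_power_closed: "f \<in> max_power n \<Longrightarrow> f \<in> carrier R"
  by (induction n arbitrary: f) (auto elim!: max_power_SucE)

lemma max_power_zero: "\<zero> \<in> max_power n"
proof (induction n)
  case (Suc n)
  show ?case by (rule max_power_SucI[OF _ Suc Suc]) auto
qed simp

lemma max_power_add: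
  "\<lbrakk>f \<in> max_power n; g \<in> max_power n\<rbrakk> \<Longrightarrow> f \<oplus> g \<in> max_power n"
proof (induction n arbitrary: f g)
  case (Suc n)
  obtain a b where ab: "a \<in> max_power n" "b \<in> max_power n" "f = x \<otimes> a \<oplus> y \<otimes> b"
    using Suc.prems(1) by (rule max_power_SucE)
  obtain c d where cd: "c \<in> max_power n" "d \<in> max_power n" "g = x \<otimes> c \<oplus> y \<otimes> d"
    using Suc.prems(2) by (rule max_power_SucE)
  note [simp] = ab(1,2)[THEN max_power_closed] cd(1,2)[THEN max_power_closed]
  have "f \<oplus> g = x \<otimes> (a \<oplus> c) \<oplus> y \<otimes> (b \<oplus> d)"
    by (simp add: ab cd r_distr a_ac)
  then show ?case by (rule max_power_SucI) (intro Suc.IH ab cd)+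
qed simp

lemma max_power_mult_left:
  "\<lbrakk>f \<in> max_power n; r \<in> carrier R\<rbrakk> \<Longrightarrow> r \<otimes> f \<in> max_power n"
proof (induction n arbitrary: f)
  case (Suc n)
  obtain a b where ab: "a \<in> max_power n" "b \<in> max_power n" "f = x \<otimes> a \<oplus> y \<otimes> b"
    using Suc.prems(1) by (rule max_power_SucE)
  note [simp] = ab(1,2)[THEN max_power_closed] Suc.prems(2)
  have "r \<otimes> f = x \<otimes> (r \<otimes> a) \<oplus> y \<otimes> (r \<otimes> b)"
    by (simp add: ab r_distr m_ac)
  then show ?case by (rule max_power_SucI) (intro Suc.IH ab Suc.prems)+
qed simp

lemma max_power_minus:
  assumes "f \<in> max_power n" "g \<in> max_power n"
  shows "f \<ominus> g \<in> max_power n"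
proof -
  have "\<ominus> \<one> \<otimes> g \<in> max_power n" by (rule max_power_mult_left[OF assms(2)]) simp
  then show ?thesis
    unfolding a_minus_def using assms(2)[THEN max_power_closed] max_power_add[OF assms(1)]
    by (simp add: l_minus)
qed

lemma max_power_mult:
  "\<lbrakk>f \<in> max_power n; g \<in> max_power k\<rbrakk> \<Longrightarrow> f \<otimes> g \<in> max_power (n + k)"
proof (induction n arbitrary: f)
  case 0
  then show ?case by (simp add: max_power_mult_left)
next
  case (Suc n)
  obtain a b where ab: "a \<in> max_power n" "b \<in> max_power n" "f = x \<otimes> a \<oplus> y \<otimes> b"
    using Suc.prems(1) by (rule max_power_SucE)
  note [simp] = ab(1,2)[THEN max_power_closed] Suc.prems(2)[THEN max_power_closed]
  have "f \<otimes> g = x \<otimes> (a \<otimes> g) \<oplus> y \<otimes> (b \<otimes> g)"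
    by (simp add: ab l_distr m_assoc)
  then show ?case
    unfolding add_Suc by (rule max_power_SucI) (intro Suc.IH ab Suc.prems)+
qed

lemma max_power_1: "max_power (Suc 0) = \<mm>"
  unfolding max_power.simps(2) max_power.simps(1) maximal_eq_pair_ideal pair_ideal_def ..

lemma max_power_antimono: "n \<le> k \<Longrightarrow> f \<in> max_power k \<Longrightarrow> f \<in> max_power n"
proof (induction k arbitrary: f rule: dec_induct)
  case (step k)
  from step.prems obtain a b where "a \<in> max_power k" "b \<in> max_power k" "f = x \<otimes> a \<oplus> y \<otimes> b"
    by (rule max_power_SucE)
  then show ?case using step.IH by (simp add: max_power_add max_power_mult_left)
qed

lemma max_power_nat_pow: "f \<in> \<mm> \<Longrightarrow> f [^] n \<in> max_power n"
proof (induction n)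
  case (Suc n)
  then show ?case using max_power_mult[of "f [^] n" n f "Suc 0"] by (simp add: max_power_1)
qed simp

lemma max_power_subset_pair_ideal: "f \<in> max_power n \<Longrightarrow> f \<in> pair_ideal x (y [^] n)"
proof (induction n arbitrary: f)
  case 0
  then show ?case by (intro pair_idealI[of _ _ \<zero> _ f]) auto
next
  case (Suc n)
  obtain a b where ab: "a \<in> max_power n" "b \<in> max_power n" "f = x \<otimes> a \<oplus> y \<otimes> b"
    using Suc.prems by (rule max_power_SucE)
  obtain s t where [simp]: "s \<in> carrier R" "t \<in> carrier R" and b: "b = x \<otimes> s \<oplus> y [^] n \<otimes> t"
    using Suc.IH[OF ab(2)] by (rule pair_idealE)
  note [simp] = ab(1,2)[THEN max_power_closed]
  have "f = x \<otimes> (a \<oplus> y \<otimes> s) \<oplus> y [^] Suc n \<otimes> t"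
    unfolding ab(3) b by (simp add: r_distr m_ac a_ac)
  then show ?case by (rule pair_idealI) auto
qed

text \<open>Every monomial of degree \<open>n + 1\<close> in \<open>x\<close> and \<open>y\<close>
  except \<open>y^(n+1)\<close> contains \<open>x\<close>. Unlike mere membership in
  \<open>(x, y^(n+1))\<close>, this form records that the cofactor of \<open>x\<close> lies in the
  \<open>n\<close>-th power.\<close>

lemma max_power_Suc_decomp:
  assumes "f \<in> max_power (Suc n)"
  obtains u c where "u \<in> carrier R" "c \<in> max_power n" "f = y [^] Suc n \<otimes> u \<oplus> x \<otimes> c"
proof -
  have "\<exists>u\<in>carrier R. \<exists>c\<in>max_power n. f = y [^] Suc n \<otimes> u \<oplus> x \<otimes> c"
    using assms
  proof (induction n arbitrary: f)
    case 0
    then show ?case by (fastforce elim!: max_power_SucE simp: a_comm)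
  next
    case (Suc n)
    obtain a b where ab: "a \<in> max_power (Suc n)" "b \<in> max_power (Suc n)" "f = x \<otimes> a \<oplus> y \<otimes> b"
      using Suc.prems by (rule max_power_SucE)
    obtain u c where [simp]: "u \<in> carrier R" and c: "c \<in> max_power n"
      and b: "b = y [^] Suc n \<otimes> u \<oplus> x \<otimes> c" using Suc.IH[OF ab(2)] by blast
    note [simp] = ab(1,2)[THEN max_power_closed] c[THEN max_power_closed]
    have "f = y [^] Suc (Suc n) \<otimes> u \<oplus> x \<otimes> (a \<oplus> y \<otimes> c)"
      unfolding ab(3) b by (simp add: r_distr m_ac a_ac)
    moreover have "a \<oplus> y \<otimes> c \<in> max_power (Suc n)"
      using max_power_mult[of y "Suc 0" c n] c ab y_mem by (intro max_power_add) (auto simp: max_power_1)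
    ultimately show ?case using \<open>u \<in> carrier R\<close> by blast
  qed
  then show ?thesis using that by blast
qed

text \<open>Among the terms of \<open>f\<close> of lowest degree, the leading one is that with the smallest power of
  \<open>x\<close>.\<close>
lemma leading_term:
  assumes "f \<in> max_power n" "f \<notin> max_power (Suc n)"
  obtains s p u c e where "n = s + p" "u \<in> Units R" "c \<in> carrier R" "e \<in> max_power (Suc n)"
    "f = x [^] s \<otimes> (y [^] p \<otimes> u \<oplus> x \<otimes> c) \<oplus> e"
proof -
  have "\<exists>s p. \<exists>u\<in>Units R. \<exists>c\<in>carrier R. \<exists>e\<in>max_power (Suc n).
      n = s + p \<and> f = x [^] s \<otimes> (y [^] p \<otimes> u \<oplus> x \<otimes> c) \<oplus> e"
    using assms
  proof (induction n arbitrary: f)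
    case 0
    then have f: "f \<in> Units R" using not_mem_maximal_imp_Units by (simp add: max_power_1)
    show ?case
      by (intro exI[of _ 0] bexI[of _ f] bexI[of _ \<zero>]) (use f max_power_zero in auto)
  next
    case (Suc n)
    obtain u c where [simp]: "u \<in> carrier R" and c: "c \<in> max_power n"
      and f: "f = y [^] Suc n \<otimes> u \<oplus> x \<otimes> c" using Suc.prems(1) by (rule max_power_Suc_decomp)
    note [simp] = c[THEN max_power_closed]
    show ?case
    proof (cases "u \<in> Units R")
      case True
      show ?thesis
        by (intro exI[of _ 0] exI[of _ "Suc n"] bexI[of _ u] bexI[of _ c] bexI[of _ \<zero>])
          (use True f max_power_zero in auto)
    next
      \<comment> \<open>The term \<open>y^(n+1) u\<close> now has degree at least
        \<open>n + 2\<close> and joins the error term. The rest is \<open>x c\<close> with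
        \<open>c\<close> of degree exactly \<open>n\<close>, so the induction hypothesis applies to
        \<open>c\<close>.\<close>
      case False
      then have "u \<in> max_power (Suc 0)" using not_mem_maximal_imp_Units[of u] by (auto simp: max_power_1)
      then have yu: "y [^] Suc n \<otimes> u \<in> max_power (Suc (Suc n))"
        using max_power_mult[OF max_power_nat_pow[OF y_mem, of "Suc n"]] by fastforce
      have x: "x \<otimes> g \<in> max_power (Suc k)" if "g \<in> max_power k" for g k
        using max_power_mult[of x "Suc 0" g k] that x_mem by (simp add: max_power_1)
      have "c \<notin> max_power (Suc n)"
        using Suc.prems(2) x max_power_add yu unfolding f by blast
      then obtain s p u' c' e where u': "u' \<in> Units R" and [simp]: "c' \<in> carrier R"
        and e: "e \<in> max_power (Suc n)" and "n = s + p"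
        and c_eq: "c = x [^] s \<otimes> (y [^] p \<otimes> u' \<oplus> x \<otimes> c') \<oplus> e"
        using Suc.IH[OF c] by blast
      note [simp] = e[THEN max_power_closed] Units_closed[OF u']
      have "f = x [^] Suc s \<otimes> (y [^] p \<otimes> u' \<oplus> x \<otimes> c') \<oplus> (x \<otimes> e \<oplus> y [^] Suc n \<otimes> u)"
        unfolding f c_eq by (simp add: r_distr m_ac a_ac)
      moreover have "x \<otimes> e \<oplus> y [^] Suc n \<otimes> u \<in> max_power (Suc (Suc n))"
        using x[OF e] yu by (rule max_power_add)
      moreover have "Suc n = Suc s + p" using \<open>n = s + p\<close> by simp
      ultimately show ?thesis using u' \<open>c' \<in> carrier R\<close> by blast
    qed
  qed
  then show ?thesis using that by blast
qed

end

text \<open>The form in which regularity in dimension two is used: \<open>x\<close> is a nonzero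
  element of a domain, and \<open>y\<close> is not nilpotent modulo \<open>x\<close>.\<close>

locale regular_parameters = two_generated_local_ring + domain R +
  assumes x_nonzero: "x \<noteq> \<zero>" and x_not_divides: "\<not> x divides y [^] (n::nat)"
begin

text \<open>If \<open>x\<close> does not divide \<open>h\<close>, then \<open>h\<close> is
  \<open>y^k u\<close> modulo \<open>x\<close> with a unit \<open>u\<close>, and \<open>y h\<close>
  is \<open>y^(k+1) u\<close>, which \<open>x\<close> does not divide. Thus \<open>x, y\<close> is a
  regular sequence.\<close>

lemma divides_y_mult_cancel:
  assumes "h \<in> carrier R" "x divides y \<otimes> h"
  shows "x divides h"
proof (rule ccontr)
  assume "\<not> x divides h"
  then obtain a k u where [simp]: "a \<in> carrier R" and u: "u \<in> Units R"
    and h: "h = x \<otimes> a \<oplus> y [^] (k::nat) \<otimes> u" by (rule not_divides_residue[OF assms(1)])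
  obtain c where [simp]: "c \<in> carrier R" and c: "y \<otimes> h = x \<otimes> c"
    using assms(2) unfolding factor_def by blast
  note [simp] = Units_closed[OF u]
  define q where "q = y [^] k"
  have [simp]: "q \<in> carrier R" by (simp add: q_def)
  have "u \<otimes> (q \<otimes> y) = y \<otimes> (x \<otimes> a \<oplus> q \<otimes> u) \<ominus> x \<otimes> (y \<otimes> a)"
    by (rule sym, subst minus_eq_iff) (simp_all add: r_distr m_ac a_ac)
  also have "\<dots> = x \<otimes> c \<ominus> x \<otimes> (y \<otimes> a)" using c h by (simp add: q_def)
  also have "\<dots> = x \<otimes> (c \<ominus> y \<otimes> a)" by (simp add: r_distr_minus)
  finally have "x divides u \<otimes> (q \<otimes> y)" unfolding factor_def by auto
  then have "x divides q \<otimes> y" by (rule divides_Units_mult_cancel[OF u, rotated 2]) auto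
  then show False using x_not_divides[of "Suc k"] by (simp add: q_def)
qed

text \<open>In \<open>x f = x a + y b\<close> the element \<open>x\<close> divides
  \<open>y b\<close>, hence \<open>b = x d\<close>. Induction bounds the order of \<open>d\<close>
  from below, and \<open>f = a + y d\<close>. So \<open>x\<close> is no zero divisor in the
  associated graded ring.\<close>

lemma max_power_x_mult_cancel:
  "\<lbrakk>f \<in> carrier R; x \<otimes> f \<in> max_power (Suc n)\<rbrakk> \<Longrightarrow> f \<in> max_power n"
proof (induction n arbitrary: f)
  case (Suc n)
  obtain a b where ab: "a \<in> max_power (Suc n)" "b \<in> max_power (Suc n)" "x \<otimes> f = x \<otimes> a \<oplus> y \<otimes> b"
    using Suc.prems(2) by (rule max_power_SucE)
  note [simp] = ab(1,2)[THEN max_power_closed] Suc.prems(1)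
  have "y \<otimes> b = (x \<otimes> a \<oplus> y \<otimes> b) \<ominus> x \<otimes> a"
    by (rule sym, subst minus_eq_iff) (simp_all add: a_comm)
  also have "\<dots> = x \<otimes> (f \<ominus> a)" unfolding ab(3)[symmetric]
    by (simp add: r_distr_minus)
  finally have "x divides y \<otimes> b" unfolding factor_def by auto
  then have "x divides b" by (rule divides_y_mult_cancel[rotated]) simp
  then obtain d where [simp]: "d \<in> carrier R" and d: "b = x \<otimes> d" unfolding factor_def by blast
  have "d \<in> max_power n" using Suc.IH[of d] ab(2) d by simp
  moreover have "x \<otimes> f = x \<otimes> (a \<oplus> y \<otimes> d)"
    unfolding ab(3) d by (simp add: r_distr m_ac)
  then have "f = a \<oplus> y \<otimes> d" using x_nonzero by (simp add: m_lcancel)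
  ultimately show ?case
    using max_power_mult[of y "Suc 0" d n] ab y_mem by (auto simp: max_power_1 intro!: max_power_add)
qed simp

lemma max_power_x_power_mult_cancel:
  "\<lbrakk>f \<in> carrier R; x [^] k \<otimes> f \<in> max_power (k + n)\<rbrakk> \<Longrightarrow> f \<in> max_power n"
proof (induction k)
  case (Suc k)
  then have "x \<otimes> (x [^] k \<otimes> f) \<in> max_power (Suc (k + n))" by (simp add: m_ac)
  then show ?case using Suc max_power_x_mult_cancel[of "x [^] k \<otimes> f"] by simp
qed simp

text \<open>The associated graded ring is a domain: the leading terms multiply to
  \<open>x^(s+t) y^(p+q) u v\<close>. If \<open>f g\<close> had larger order, cancelling
  \<open>x^(s+t)\<close> and reducing modulo \<open>x\<close> would make \<open>x\<close> divide
  \<open>y^(p+q)\<close>.\<close>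

lemma max_power_mult_strict:
  assumes f: "f \<in> max_power n" "f \<notin> max_power (Suc n)"
    and g: "g \<in> max_power k" "g \<notin> max_power (Suc k)"
  shows "f \<otimes> g \<notin> max_power (Suc (n + k))"
proof
  assume fg: "f \<otimes> g \<in> max_power (Suc (n + k))"
  obtain s p u c e where n: "n = s + p" and u: "u \<in> Units R" and [simp]: "c \<in> carrier R"
    and e: "e \<in> max_power (Suc n)" and f_eq: "f = x [^] s \<otimes> (y [^] p \<otimes> u \<oplus> x \<otimes> c) \<oplus> e"
    using f by (rule leading_term)
  obtain t q v d e' where k: "k = t + q" and v: "v \<in> Units R" and [simp]: "d \<in> carrier R"
    and e': "e' \<in> max_power (Suc k)" and g_eq: "g = x [^] t \<otimes> (y [^] q \<otimes> v \<oplus> x \<otimes> d) \<oplus> e'"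
    using g by (rule leading_term)
  define A B X where "A = y [^] p \<otimes> u" and "B = y [^] q \<otimes> v" and "X = x [^] (s + t)"
  note [simp] = Units_closed[OF u] Units_closed[OF v] f(1)[THEN max_power_closed]
    g(1)[THEN max_power_closed] e[THEN max_power_closed] e'[THEN max_power_closed]
  have [simp]: "A \<in> carrier R" "B \<in> carrier R" "X \<in> carrier R" by (auto simp: A_def B_def X_def)
  \<comment> \<open>\<open>w\<close> collects the multiples of \<open>x\<close>:
    \<open>(A + x c) (B + x d) = A B + x w\<close>.\<close>
  define w where "w = A \<otimes> d \<oplus> c \<otimes> (B \<oplus> x \<otimes> d)"
  have [simp]: "w \<in> carrier R" by (auto simp: w_def)
  have f': "x [^] s \<otimes> (A \<oplus> x \<otimes> c) = f \<ominus> e"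
    unfolding A_def f_eq by (simp add: a_minus_def a_assoc r_neg)
  have g': "x [^] t \<otimes> (B \<oplus> x \<otimes> d) = g \<ominus> e'"
    unfolding B_def g_eq by (simp add: a_minus_def a_assoc r_neg)
  have "X \<otimes> (A \<otimes> B \<oplus> x \<otimes> w) = X \<otimes> ((A \<oplus> x \<otimes> c) \<otimes> (B \<oplus> x \<otimes> d))"
    unfolding w_def by (simp add: r_distr l_distr m_ac a_ac)
  also have "\<dots> = (x [^] s \<otimes> (A \<oplus> x \<otimes> c)) \<otimes> (x [^] t \<otimes> (B \<oplus> x \<otimes> d))"
    by (simp add: X_def nat_pow_mult[symmetric] m_ac)
  also have "\<dots> = (f \<ominus> e) \<otimes> (g \<ominus> e')" unfolding f' g' ..
  \<comment> \<open>The error terms contribute only in degree at least \<open>n + k + 1\<close>,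
    where \<open>f g\<close> lies by assumption.\<close>
  also have "\<dots> = f \<otimes> g \<ominus> (f \<otimes> e' \<oplus> e \<otimes> (g \<ominus> e'))"
    by (simp add: a_minus_def r_distr l_distr r_minus l_minus minus_add a_ac)
  also have "\<dots> \<in> max_power (Suc (n + k))"
  proof -
    have "g \<ominus> e' \<in> max_power k"
      using g(1) e' by (intro max_power_minus) (auto intro: max_power_antimono[of k "Suc k"])
    then show ?thesis
      using max_power_mult[OF f(1) e'] max_power_mult[OF e] fg
      by (intro max_power_minus max_power_add) auto
  qed
  finally have "x [^] (s + t) \<otimes> (A \<otimes> B \<oplus> x \<otimes> w) \<in> max_power ((s + t) + Suc (p + q))"
    using n k by (simp add: X_def ac_simps)
  then have "A \<otimes> B \<oplus> x \<otimes> w \<in> max_power (Suc (p + q))"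
    by (rule max_power_x_power_mult_cancel[rotated]) simp
  then obtain s' t' where [simp]: "s' \<in> carrier R" "t' \<in> carrier R"
    and eq: "A \<otimes> B \<oplus> x \<otimes> w = x \<otimes> s' \<oplus> y [^] Suc (p + q) \<otimes> t'"
    using max_power_subset_pair_ideal by (blast elim: pair_idealE)
  define Y where "Y = y [^] (p + q)"
  have [simp]: "Y \<in> carrier R" by (simp add: Y_def)
  have AB: "A \<otimes> B = Y \<otimes> (u \<otimes> v)"
    by (simp add: A_def B_def Y_def nat_pow_mult[symmetric] m_ac)
  have "x \<otimes> w \<oplus> Y \<otimes> (u \<otimes> v) = x \<otimes> s' \<oplus> Y \<otimes> y \<otimes> t'"
    using eq unfolding AB by (simp add: Y_def a_comm)
  then have "Y \<otimes> (u \<otimes> v) \<ominus> Y \<otimes> y \<otimes> t' = x \<otimes> s' \<ominus> x \<otimes> w"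
    by (rule minus_eq_minus_if_add_eq) auto
  then have "(u \<otimes> v \<ominus> y \<otimes> t') \<otimes> Y = x \<otimes> (s' \<ominus> w)"
    by (simp add: l_distr_minus r_distr_minus m_ac)
  then have "x divides (u \<otimes> v \<ominus> y \<otimes> t') \<otimes> Y" unfolding factor_def by auto
  then have "x divides Y"
    by (rule divides_Units_mult_cancel[rotated 3])
      (auto intro!: Units_minus_maximal \<mm>.I_r_closed u v y_mem)
  then show False using x_not_divides by (simp add: Y_def)
qed

end

section \<open>Comparing valuations below a given one\<close>

context noetherian_local_ring
begin

lemma valuation_add:
  "\<lbrakk>centered_valuation R \<mm> \<nu>; f \<in> carrier R; g \<in> carrier R\<rbrakk> \<Longrightarrow> min (\<nu> f) (\<nu> g) \<le> \<nu> (f \<oplus> g)"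
  by (simp add: centered_valuation_def)

lemma valuation_mult:
  "\<lbrakk>centered_valuation R \<mm> \<nu>; f \<in> carrier R; g \<in> carrier R\<rbrakk> \<Longrightarrow> \<nu> (f \<otimes> g) = \<nu> f + \<nu> g"
  by (simp add: centered_valuation_def)

lemma valuation_one: "centered_valuation R \<mm> \<nu> \<Longrightarrow> \<nu> \<one> = 0"
  by (simp add: centered_valuation_def)

lemma valuation_zero: "centered_valuation R \<mm> \<nu> \<Longrightarrow> \<nu> \<zero> = Orderings.top"
  by (simp add: centered_valuation_def)

lemma valuation_Units:
  assumes \<nu>: "centered_valuation R \<mm> \<nu>" and u: "u \<in> Units R"
  shows "\<nu> u = 0"
  using valuation_mult[OF \<nu>, of u "inv u"] valuation_one[OF \<nu>] u Units_closed[OF u]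
  by (simp add: Units_r_inv)

lemma valuation_diff:
  assumes \<nu>: "centered_valuation R \<mm> \<nu>" and fg: "f \<in> carrier R" "g \<in> carrier R"
  shows "min (\<nu> f) (\<nu> g) \<le> \<nu> (f \<ominus> g)"
proof -
  have "\<ominus> \<one> \<in> Units R" by (rule Units_minus_one_closed)
  then have "\<nu> (\<ominus> \<one> \<otimes> g) = \<nu> g"
    using valuation_mult[OF \<nu>, of "\<ominus> \<one>" g] valuation_Units[OF \<nu>, of "\<ominus> \<one>"] fg by simp
  then show ?thesis
    using valuation_add[OF \<nu>, of f "\<ominus> g"] fg by (simp add: a_minus_def l_minus)
qed

lemma valuation_nat_pow:
  assumes \<nu>: "centered_valuation R \<mm> \<nu>" and "f \<in> carrier R" "\<nu> f = 1"
  shows "\<nu> (f [^] (n::nat)) = of_nat n"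
  using assms by (induction n) (simp_all add: valuation_one valuation_mult)

text \<open>An infimum equal to 1 provides an \<open>f\<close> in \<open>\<mm>\<close> with
  \<open>0 < \<nu> f < \<infinity>\<close>, which witnesses both conditions of properness.\<close>

lemma valuation_carrier_iff:
  "\<nu> \<in> carrier (valuation_poset R \<mm>) \<longleftrightarrow> centered_valuation R \<mm> \<nu> \<and> (INF f\<in>\<mm>. \<nu> f) = 1"
proof -
  have "proper_valuation R \<mm> \<nu>" if \<nu>: "centered_valuation R \<mm> \<nu>" and inf: "(INF f\<in>\<mm>. \<nu> f) = 1"
  proof -
    have "(INF f\<in>\<mm>. \<nu> f) < Orderings.top" by (simp add: inf)
    then obtain f where f: "f \<in> \<mm>" "\<nu> f < Orderings.top" by (auto simp: INF_less_iff)
    then have "f \<noteq> \<zero>" "\<nu> f > 0" "f \<in> carrier R" "\<nu> f \<noteq> \<infinity>"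
      using valuation_zero[OF \<nu>] \<nu> by (auto simp: centered_valuation_def infinity_ennreal_def)
    then show ?thesis
      unfolding proper_valuation_def using f by (metis DiffI imageI less_irrefl singletonD)
  qed
  then show ?thesis
    by (auto simp: valuation_poset_def normalized_valuation_def)
qed

lemma le_valuation_poset [simp]:
  "\<kappa> \<sqsubseteq>\<^bsub>valuation_poset R \<mm>\<^esub> \<nu> \<longleftrightarrow> (\<forall>f\<in>carrier R. \<kappa> f \<le> \<nu> f)"
  by (simp add: valuation_poset_def)

lemma normalized_ge_one:
  assumes "\<nu> \<in> carrier (valuation_poset R \<mm>)" "f \<in> \<mm>"
  shows "1 \<le> \<nu> f"
  using assms INF_lower[of f \<mm> \<nu>] by (simp add: valuation_carrier_iff)

text \<open>The infimum over \<open>\<mm>\<close> is at most 1 by comparison with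
  \<open>\<nu>\<close>, and at least 1 by the last premise.\<close>

lemma valuation_poset_carrierI:
  assumes "centered_valuation R \<mm> \<kappa>" and \<nu>: "\<nu> \<in> carrier (valuation_poset R \<mm>)"
    and "\<And>f. f \<in> carrier R \<Longrightarrow> \<kappa> f \<le> \<nu> f" and "\<And>f. f \<in> \<mm> \<Longrightarrow> 1 \<le> \<kappa> f"
  shows "\<kappa> \<in> carrier (valuation_poset R \<mm>)"
proof -
  have "(INF f\<in>\<mm>. \<kappa> f) \<le> (INF f\<in>\<mm>. \<nu> f)" by (rule INF_mono) (use assms(3) \<mm>.a_Hcarr in blast)
  moreover have "1 \<le> (INF f\<in>\<mm>. \<kappa> f)" by (rule INF_greatest) (rule assms(4))
  ultimately show ?thesis using \<nu> assms(1) by (simp add: valuation_carrier_iff)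
qed

end

context two_generated_local_ring
begin

text \<open>Since \<open>\<nu> (x s + y t)\<close> is at least
  \<open>min (\<nu> x) (\<nu> y)\<close>, the infimum over \<open>\<mm>\<close> is attained at a
  generator.\<close>

lemma normalized_generator:
  assumes \<nu>: "\<nu> \<in> carrier (valuation_poset R \<mm>)"
  shows "\<nu> x = 1 \<or> \<nu> y = 1"
proof -
  have \<nu>c: "centered_valuation R \<mm> \<nu>" and inf: "(INF f\<in>\<mm>. \<nu> f) = 1"
    using \<nu> by (auto simp: valuation_carrier_iff)
  have "min (\<nu> x) (\<nu> y) \<le> (INF f\<in>\<mm>. \<nu> f)"
  proof (rule INF_greatest)
    fix f assume "f \<in> \<mm>"
    then obtain s t where [simp]: "s \<in> carrier R" "t \<in> carrier R" and f: "f = x \<otimes> s \<oplus> y \<otimes> t"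
      unfolding maximal_eq_pair_ideal by (rule pair_idealE)
    have "min (\<nu> x) (\<nu> y) \<le> min (\<nu> x + \<nu> s) (\<nu> y + \<nu> t)"
      by (intro min.mono add_increasing2) auto
    also have "\<dots> \<le> \<nu> f"
      unfolding f using valuation_add[OF \<nu>c, of "x \<otimes> s" "y \<otimes> t"] by (simp add: valuation_mult[OF \<nu>c])
    finally show "min (\<nu> x) (\<nu> y) \<le> \<nu> f" .
  qed
  then have "min (\<nu> x) (\<nu> y) \<le> 1" by (simp only: inf)
  then show ?thesis
    using normalized_ge_one[OF \<nu> x_mem] normalized_ge_one[OF \<nu> y_mem]
    by (auto simp: min_le_iff_disj intro: antisym)
qed

text \<open>Division by \<open>p\<close> with remainder: as long as \<open>g\<close> lies in
  \<open>(x, p)\<close>, it splits into a multiple of \<open>p\<close> and a multiple of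
  \<open>x\<close>, which raises \<open>j\<close> by one. \<open>N\<close> bounds the number of
  rounds.\<close>

lemma expansion:
  assumes [simp]: "p \<in> carrier R" and f: "f \<in> carrier R"
  obtains Q j g where "Q \<in> carrier R" "g \<in> carrier R" "f = p \<otimes> Q \<oplus> x [^] (j::nat) \<otimes> g"
    "j = N \<or> g \<notin> pair_ideal x p"
proof -
  have "\<exists>Q\<in>carrier R. \<exists>g\<in>carrier R. \<exists>j::nat. f = p \<otimes> Q \<oplus> x [^] j \<otimes> g \<and> (j = N \<or> g \<notin> pair_ideal x p)"
  proof (induction N)
    case 0
    show ?case by (intro bexI[of _ \<zero>] bexI[of _ f] exI[of _ 0]) (use f in auto)
  next
    case (Suc N)
    then obtain Q g j where [simp]: "Q \<in> carrier R" "g \<in> carrier R"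
      and f_eq: "f = p \<otimes> Q \<oplus> x [^] (j::nat) \<otimes> g" and j: "j = N \<or> g \<notin> pair_ideal x p" by blast
    show ?case
    proof (cases "g \<in> pair_ideal x p")
      case False
      then show ?thesis using f_eq \<open>Q \<in> carrier R\<close> \<open>g \<in> carrier R\<close> by blast
    next
      case True
      then obtain s t where [simp]: "s \<in> carrier R" "t \<in> carrier R" and g: "g = x \<otimes> s \<oplus> p \<otimes> t"
        by (rule pair_idealE)
      have "f = p \<otimes> (Q \<oplus> x [^] N \<otimes> t) \<oplus> x [^] Suc N \<otimes> s"
        using j True unfolding f_eq g by (simp add: r_distr m_ac a_ac)
      moreover have "Q \<oplus> x [^] N \<otimes> t \<in> carrier R" by simp
      ultimately show ?thesis using \<open>s \<in> carrier R\<close> by blast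
    qed
  qed
  then show ?thesis using that by blast
qed

text \<open>The bound \<open>min (\<kappa> f) n \<le> \<rho> f\<close> is shown by induction on \<open>n\<close>: passing from \<open>f = p Q + r\<close> to \<open>Q\<close>
  costs \<open>\<kappa> p \<ge> 1\<close>. There is no cancellation between \<open>p Q\<close> and a remainder \<open>r\<close> with \<open>\<kappa> r = \<mu> r\<close>,
  since otherwise \<open>\<mu> (p Q) \<le> \<mu> r = \<kappa> (p Q)\<close>, contradicting \<open>\<kappa> p < \<mu> p\<close>.\<close>
lemma valuation_le_if_key:
  assumes \<kappa>: "centered_valuation R \<mm> \<kappa>" and \<rho>: "centered_valuation R \<mm> \<rho>"
    and \<mu>: "centered_valuation R \<mm> \<mu>"
    and x: "\<kappa> x = 1" "\<rho> x = 1" "\<mu> x = 1"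
    and \<kappa>\<mu>: "\<And>f. f \<in> carrier R \<Longrightarrow> \<kappa> f \<le> \<mu> f"
    and p [simp]: "p \<in> carrier R" and p_lt: "\<kappa> p < \<mu> p" and p_le: "\<kappa> p \<le> \<rho> p" and p_one: "1 \<le> \<kappa> p"
    and eq: "\<And>g. \<lbrakk>g \<in> carrier R; g \<notin> pair_ideal x p\<rbrakk> \<Longrightarrow> \<kappa> g = \<mu> g \<and> \<rho> g = \<mu> g"
    and f: "f \<in> carrier R"
  shows "\<kappa> f \<le> \<rho> f"
proof -
  have bound: "min (\<kappa> f) (of_nat n) \<le> \<rho> f" for n
    using f
  proof (induction n arbitrary: f)
    case (Suc n)
    note [simp] = Suc.prems
    obtain Q j g where [simp]: "Q \<in> carrier R" "g \<in> carrier R"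
      and f_eq: "f = p \<otimes> Q \<oplus> x [^] (j::nat) \<otimes> g" and j: "j = Suc n \<or> g \<notin> pair_ideal x p"
      by (rule expansion[OF p Suc.prems])
    define r where "r = x [^] j \<otimes> g"
    have r [simp]: "r \<in> carrier R" by (simp add: r_def)
    have f_r: "f = p \<otimes> Q \<oplus> r" and pQ: "p \<otimes> Q = f \<ominus> r" and r_eq: "r = f \<ominus> p \<otimes> Q"
    proof -
      show "f = p \<otimes> Q \<oplus> r" by (simp add: f_eq r_def)
      then show "p \<otimes> Q = f \<ominus> r" by (simp add: a_minus_def a_assoc r_neg)
      show "r = f \<ominus> p \<otimes> Q"
        using \<open>f = p \<otimes> Q \<oplus> r\<close> by (simp add: a_minus_def a_ac r_neg)
    qed
    have r_val: "\<nu> r = of_nat j + \<nu> g" if "centered_valuation R \<mm> \<nu>" "\<nu> x = 1" for \<nu>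
      unfolding r_def using that by (simp add: valuation_mult valuation_nat_pow)
    have \<rho>_pQ: "min (\<kappa> (p \<otimes> Q)) (of_nat (Suc n)) \<le> \<rho> (p \<otimes> Q)"
    proof -
      have "min (\<kappa> (p \<otimes> Q)) (of_nat (Suc n)) \<le> min (\<kappa> p + \<kappa> Q) (\<kappa> p + of_nat n)"
        using p_one by (intro min.mono) (auto simp: valuation_mult[OF \<kappa>] intro: add_right_mono)
      also have "\<dots> \<le> \<kappa> p + min (\<kappa> Q) (of_nat n)" by (auto simp: min_def)
      also have "\<dots> \<le> \<rho> p + \<rho> Q" by (intro add_mono p_le Suc.IH) simp
      finally show ?thesis by (simp add: valuation_mult[OF \<rho>])
    qed
    have "min (\<kappa> f) (of_nat (Suc n)) \<le> \<kappa> (p \<otimes> Q) \<and> min (\<kappa> f) (of_nat (Suc n)) \<le> \<rho> r"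
    proof (cases "g \<in> pair_ideal x p")
      \<comment> \<open>Here the remainder has value at least \<open>n + 1\<close> under both
        valuations, so the truncation absorbs it.\<close>
      case True
      with j have "j = Suc n" by simp
      then have ge: "of_nat (Suc n) \<le> \<kappa> r" "of_nat (Suc n) \<le> \<rho> r"
        using r_val[OF \<kappa> x(1)] r_val[OF \<rho> x(2)] by (auto intro: add_increasing2)
      then have "min (\<kappa> f) (of_nat (Suc n)) \<le> min (\<kappa> f) (\<kappa> r)" by (intro min.mono) auto
      also have "\<dots> \<le> \<kappa> (p \<otimes> Q)" unfolding pQ by (rule valuation_diff[OF \<kappa>]) auto
      finally show ?thesis using ge by (auto intro: min.coboundedI2)
    next
      case False
      then have r_same: "\<kappa> r = \<mu> r" "\<rho> r = \<mu> r"
        using eq[of g] r_val[OF \<kappa> x(1)] r_val[OF \<rho> x(2)] r_val[OF \<mu> x(3)] by auto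
      have "\<kappa> f \<le> \<kappa> r"
      proof (rule ccontr)
        assume "\<not> \<kappa> f \<le> \<kappa> r"
        then have lt: "\<kappa> r < \<kappa> f" by simp
        then have lt': "\<mu> r < \<mu> f" using r_same \<kappa>\<mu>[of f] by simp
        have "min (\<mu> f) (\<mu> (p \<otimes> Q)) \<le> \<mu> r"
          using valuation_diff[OF \<mu>, of f "p \<otimes> Q"] by (simp add: r_eq[symmetric])
        then have "\<mu> (p \<otimes> Q) \<le> \<kappa> r" using lt' r_same by (auto simp: min_le_iff_disj)
        also have "\<kappa> r = min (\<kappa> f) (\<kappa> r)" using lt by simp
        also have "\<dots> \<le> \<kappa> (p \<otimes> Q)" unfolding pQ by (rule valuation_diff[OF \<kappa>]) auto
        finally have le: "\<mu> p + \<mu> Q \<le> \<kappa> p + \<kappa> Q" by (simp add: valuation_mult \<mu> \<kappa>)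
        \<comment> \<open>This yields that \<open>\<kappa> Q\<close> is finite, so that adding it to
          \<open>\<kappa> p < \<mu> p\<close> keeps the inequality strict.\<close>
        have "min (\<kappa> f) (\<kappa> (p \<otimes> Q)) \<le> \<kappa> r"
          using valuation_diff[OF \<kappa>, of f "p \<otimes> Q"] by (simp add: r_eq[symmetric])
        then have "\<kappa> (p \<otimes> Q) \<le> \<kappa> r" using lt by (auto simp: min_le_iff_disj)
        then have "\<kappa> p + \<kappa> Q \<le> \<kappa> r" by (simp add: valuation_mult[OF \<kappa>])
        also have "\<kappa> r < Orderings.top" using lt by (rule order.strict_trans2) simp
        finally have "\<kappa> Q \<noteq> \<infinity>" by auto
        then have "\<kappa> p + \<kappa> Q < \<mu> p + \<kappa> Q"
          using p_lt ennreal_add_left_cancel_less[of "\<kappa> Q"] by (simp add: add.commute)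
        also have "\<dots> \<le> \<mu> p + \<mu> Q" by (intro add_left_mono \<kappa>\<mu>) simp
        finally show False using le by simp
      qed
      moreover have "min (\<kappa> f) (\<kappa> r) \<le> \<kappa> (p \<otimes> Q)" unfolding pQ by (rule valuation_diff[OF \<kappa>]) auto
      ultimately show ?thesis using r_same by (auto simp: min_def split: if_splits)
    qed
    then have "min (\<kappa> f) (of_nat (Suc n)) \<le> min (\<rho> (p \<otimes> Q)) (\<rho> r)"
      using \<rho>_pQ by (meson min.boundedI min.cobounded2 order.trans)
    also have "\<dots> \<le> \<rho> f" unfolding f_r by (rule valuation_add[OF \<rho>]) auto
    finally show ?case .
  qed simp
  \<comment> \<open>The truncation disappears by taking \<open>n\<close> above a finite
    \<open>\<rho> f\<close>.\<close>
  show ?thesis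
  proof (cases "\<rho> f = Orderings.top")
    case False
    then obtain n where "\<rho> f < of_nat n" using ennreal_Ex_less_of_nat by (auto simp: less_top)
    then show ?thesis using bound[of n] by (auto simp: min_le_iff_disj)
  qed simp
qed

text \<open>If both valuations differ from \<open>\<mu>\<close>, each has a key element such that it
  agrees with \<open>\<mu>\<close> outside the ideal of \<open>x\<close> and this element. These two
  ideals are nested, so both valuations agree with \<open>\<mu>\<close> outside the larger one, and
  their values at its key element decide which is smaller.\<close>

lemma lower_bounds_comparable_aux:
  assumes \<kappa>: "\<kappa> \<in> carrier (valuation_poset R \<mm>)" and \<rho>: "\<rho> \<in> carrier (valuation_poset R \<mm>)"
    and \<mu>: "\<mu> \<in> carrier (valuation_poset R \<mm>)" and \<mu>x: "\<mu> x = 1"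
    and \<kappa>\<mu>: "\<And>f. f \<in> carrier R \<Longrightarrow> \<kappa> f \<le> \<mu> f" and \<rho>\<mu>: "\<And>f. f \<in> carrier R \<Longrightarrow> \<rho> f \<le> \<mu> f"
  shows "(\<forall>f\<in>carrier R. \<kappa> f \<le> \<rho> f) \<or> (\<forall>f\<in>carrier R. \<rho> f \<le> \<kappa> f)"
proof -
  \<comment> \<open>Take \<open>p\<close> with \<open>(x, p)\<close> maximal. For \<open>f\<close>
    outside \<open>(x, p)\<close> uniseriality puts \<open>p\<close> into \<open>(x, f)\<close>, so
    \<open>\<nu> f < \<mu> f\<close> would contradict maximality.\<close>
  have key: "\<exists>p\<in>carrier R. \<nu> p < \<mu> p \<and> (\<forall>f\<in>carrier R. f \<notin> pair_ideal x p \<longrightarrow> \<nu> f = \<mu> f)"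
    if "\<And>f. f \<in> carrier R \<Longrightarrow> \<nu> f \<le> \<mu> f" and "\<exists>f\<in>carrier R. \<nu> f < \<mu> f" for \<nu>
  proof -
    have "{f \<in> carrier R. \<nu> f < \<mu> f} \<noteq> {}" "{f \<in> carrier R. \<nu> f < \<mu> f} \<subseteq> carrier R"
      using that(2) by auto
    from exists_maximal_modulo[OF this x_closed] obtain p where p: "p \<in> carrier R" "\<nu> p < \<mu> p"
      and max: "\<And>f. \<lbrakk>f \<in> carrier R; \<nu> f < \<mu> f; p \<in> pair_ideal x f\<rbrakk> \<Longrightarrow> f \<in> pair_ideal x p"
      by (metis (mono_tags, lifting) mem_Collect_eq)
    have "\<nu> f = \<mu> f" if "f \<in> carrier R" "f \<notin> pair_ideal x p" for f
      using max[of f] uniserial_modulo[of f p] that p \<open>\<And>f. f \<in> carrier R \<Longrightarrow> \<nu> f \<le> \<mu> f\<close>[of f]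
      by (auto simp: order.order_iff_strict)
    then show ?thesis using p by blast
  qed
  have x_val: "\<nu> x = 1" if "\<nu> \<in> carrier (valuation_poset R \<mm>)" "\<nu> x \<le> \<mu> x" for \<nu>
    using normalized_ge_one[OF that(1) x_mem] that(2) \<mu>x by simp
  \<comment> \<open>\<open>\<mu> p > 0\<close> excludes units, so \<open>p\<close> lies in
    \<open>\<mm>\<close>.\<close>
  have one_le: "1 \<le> \<nu> p" if "\<nu> \<in> carrier (valuation_poset R \<mm>)" "\<nu> p < \<mu> p" "p \<in> carrier R" for \<nu> p
  proof -
    have "p \<notin> Units R" using valuation_Units[of \<mu> p] \<mu> that(2) by (auto simp: valuation_carrier_iff)
    then show ?thesis
      using not_mem_maximal_imp_Units normalized_ge_one[OF that(1)] that(3) by blast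
  qed
  have main: "(\<forall>f\<in>carrier R. \<kappa> f \<le> \<rho> f) \<or> (\<forall>f\<in>carrier R. \<rho> f \<le> \<kappa> f)"
    if \<kappa>: "\<kappa> \<in> carrier (valuation_poset R \<mm>)" and \<rho>: "\<rho> \<in> carrier (valuation_poset R \<mm>)"
      and \<kappa>\<mu>: "\<And>f. f \<in> carrier R \<Longrightarrow> \<kappa> f \<le> \<mu> f" and \<rho>\<mu>: "\<And>f. f \<in> carrier R \<Longrightarrow> \<rho> f \<le> \<mu> f"
      and p [simp]: "p \<in> carrier R" and pl: "\<kappa> p < \<mu> p"
      and pe: "\<And>f. \<lbrakk>f \<in> carrier R; f \<notin> pair_ideal x p\<rbrakk> \<Longrightarrow> \<kappa> f = \<mu> f"
      and q [simp]: "q \<in> carrier R"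
      and qe: "\<And>f. \<lbrakk>f \<in> carrier R; f \<notin> pair_ideal x q\<rbrakk> \<Longrightarrow> \<rho> f = \<mu> f"
      and qp: "q \<in> pair_ideal x p"
    for \<kappa> \<rho> p q
  proof -
    note c = \<kappa>[unfolded valuation_carrier_iff, THEN conjunct1]
      \<rho>[unfolded valuation_carrier_iff, THEN conjunct1]
      \<mu>[unfolded valuation_carrier_iff, THEN conjunct1]
    have eq: "\<kappa> g = \<mu> g \<and> \<rho> g = \<mu> g" if "g \<in> carrier R" "g \<notin> pair_ideal x p" for g
      using that pe[of g] qe[of g] qp pair_ideal_subset_iff[of x q p] by auto
    have xs: "\<kappa> x = 1" "\<rho> x = 1" using x_val \<kappa> \<rho> \<kappa>\<mu> \<rho>\<mu> by auto
    show ?thesis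
    proof (cases "\<kappa> p \<le> \<rho> p")
      case True
      then have "\<kappa> f \<le> \<rho> f" if "f \<in> carrier R" for f
        using valuation_le_if_key[OF c xs \<mu>x \<kappa>\<mu> p pl True one_le[OF \<kappa> pl p] eq that] by simp
      then show ?thesis by blast
    next
      case False
      \<comment> \<open>From \<open>\<rho> p < \<kappa> p < \<mu> p\<close> the element
        \<open>p\<close> is a key for \<open>\<rho>\<close> as well, and the two valuations exchange
        places.\<close>
      then have le: "\<rho> p \<le> \<kappa> p" and pl': "\<rho> p < \<mu> p" using pl by auto
      have "\<rho> f \<le> \<kappa> f" if "f \<in> carrier R" for f
        by (rule valuation_le_if_key[OF c(2,1,3) xs(2,1) \<mu>x \<rho>\<mu> p pl' le one_le[OF \<rho> pl' p] _ that])
          (use eq in auto)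
      then show ?thesis by blast
    qed
  qed
  show ?thesis
  proof (cases "(\<exists>f\<in>carrier R. \<kappa> f < \<mu> f) \<and> (\<exists>f\<in>carrier R. \<rho> f < \<mu> f)")
    case False
    \<comment> \<open>One of the two coincides with \<open>\<mu>\<close> on \<open>R\<close> and is
      therefore the larger.\<close>
    then show ?thesis using \<kappa>\<mu> \<rho>\<mu> by (metis leI order.trans)
  next
    case True
    obtain p where p: "p \<in> carrier R" "\<kappa> p < \<mu> p"
      "\<And>f. \<lbrakk>f \<in> carrier R; f \<notin> pair_ideal x p\<rbrakk> \<Longrightarrow> \<kappa> f = \<mu> f"
      using key[of \<kappa>] \<kappa>\<mu> True by blast
    obtain q where q: "q \<in> carrier R" "\<rho> q < \<mu> q"
      "\<And>f. \<lbrakk>f \<in> carrier R; f \<notin> pair_ideal x q\<rbrakk> \<Longrightarrow> \<rho> f = \<mu> f"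
      using key[of \<rho>] \<rho>\<mu> True by blast
    show ?thesis
      using uniserial_modulo[OF q(1) p(1)]
    proof
      assume "q \<in> pair_ideal x p"
      with main[OF \<kappa> \<rho> \<kappa>\<mu> \<rho>\<mu> p q(1,3)] show ?thesis by simp
    next
      assume "p \<in> pair_ideal x q"
      with main[OF \<rho> \<kappa> \<rho>\<mu> \<kappa>\<mu> q p(1,3)] show ?thesis by blast
    qed
  qed
qed

lemma swap_generators: "two_generated_local_ring R \<mm> y x"
  by unfold_locales (simp_all add: maximal_eq insert_commute)

text \<open>One generator has value 1 under \<open>\<mu>\<close>; after exchanging the generators if
  necessary, it is \<open>x\<close>.\<close>

lemma lower_bounds_comparable:
  assumes "\<kappa> \<in> carrier (valuation_poset R \<mm>)" "\<rho> \<in> carrier (valuation_poset R \<mm>)"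
    and \<mu>: "\<mu> \<in> carrier (valuation_poset R \<mm>)"
    and "\<And>f. f \<in> carrier R \<Longrightarrow> \<kappa> f \<le> \<mu> f" and "\<And>f. f \<in> carrier R \<Longrightarrow> \<rho> f \<le> \<mu> f"
  shows "(\<forall>f\<in>carrier R. \<kappa> f \<le> \<rho> f) \<or> (\<forall>f\<in>carrier R. \<rho> f \<le> \<kappa> f)"
  using normalized_generator[OF \<mu>]
proof
  assume "\<mu> x = 1"
  then show ?thesis using assms by (intro lower_bounds_comparable_aux[of \<kappa> \<rho> \<mu>])
next
  assume "\<mu> y = 1"
  then show ?thesis
    using assms by (intro two_generated_local_ring.lower_bounds_comparable_aux[OF swap_generators, of \<kappa> \<rho> \<mu>])
qed

end

section \<open>The order valuation and suprema of chains\<close>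

context regular_parameters
begin

text \<open>The \<open>\<mm>\<close>-adic order. As a supremum it takes the value
  \<open>\<infinity>\<close> exactly on the intersection of all powers of
  \<open>\<mm>\<close>.\<close>

definition max_order :: "'a \<Rightarrow> ennreal" where
  "max_order = restrict (\<lambda>f. SUP n\<in>{n. f \<in> max_power n}. of_nat n) (carrier R)"

lemma max_order_ge: "f \<in> max_power n \<Longrightarrow> of_nat n \<le> max_order f"
  using max_power_closed by (auto simp: max_order_def intro!: SUP_upper)

lemma max_order_le:
  "\<lbrakk>f \<in> carrier R; \<And>n. f \<in> max_power n \<Longrightarrow> of_nat n \<le> c\<rbrakk> \<Longrightarrow> max_order f \<le> c"
  by (auto simp: max_order_def intro!: SUP_least)

lemma max_order_eq:
  assumes "f \<in> max_power n" "f \<notin> max_power (Suc n)"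
  shows "max_order f = of_nat n"
proof (rule antisym)
  show "max_order f \<le> of_nat n"
  proof (rule max_order_le)
    show "f \<in> carrier R" using assms(1) by (rule max_power_closed)
    fix k assume "f \<in> max_power k"
    then have "k \<le> n" using assms(2) max_power_antimono[of "Suc n" k f] by linarith
    then show "of_nat k \<le> (of_nat n :: ennreal)" by simp
  qed
qed (rule max_order_ge[OF assms(1)])

lemma max_order_eq_top:
  assumes "\<And>n. f \<in> max_power n"
  shows "max_order f = \<infinity>"
  using assms[of 0] assms by (simp add: max_order_def ennreal_SUP_of_nat_eq_top)

lemma max_order_cases:
  assumes "f \<in> carrier R"
  obtains "\<And>n. f \<in> max_power n" | n where "f \<in> max_power n" "f \<notin> max_power (Suc n)"
proof (cases "\<forall>n. f \<in> max_power n")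
  case False
  have "\<exists>n. f \<in> max_power n \<and> f \<notin> max_power (Suc n)"
  proof (rule ccontr)
    assume "\<not> ?thesis"
    then have "f \<in> max_power n" for n by (induction n) (use assms in auto)
    with False show False by blast
  qed
  then show ?thesis using that by blast
qed (use that in blast)

lemma mem_max_power_iff:
  assumes "f \<in> carrier R"
  shows "f \<in> max_power n \<longleftrightarrow> of_nat n \<le> max_order f"
  using assms
proof (cases rule: max_order_cases)
  case (2 k)
  then have "f \<in> max_power n \<longleftrightarrow> n \<le> k"
    by (meson max_power_antimono not_less_eq_eq)
  then show ?thesis using 2 by (simp add: max_order_eq)
qed (auto simp: max_order_eq_top)

text \<open>Multiplicativity is \<open>max_power_mult_strict\<close> when both orders are finite.
  Otherwise one factor lies in all powers of \<open>\<mm>\<close>, and so does the product.\<close>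

lemma centered_valuation_max_order: "centered_valuation R \<mm> max_order"
  unfolding centered_valuation_def
proof (intro conjI ballI)
  show "max_order \<in> extensional (carrier R)" by (simp add: max_order_def)
next
  fix f g assume fg: "f \<in> carrier R" "g \<in> carrier R"
  have *: "max_order h \<le> max_order (h \<oplus> k)"
    if "h \<in> carrier R" "k \<in> carrier R" "max_order h \<le> max_order k" for h k
  proof (rule max_order_le[OF that(1)])
    fix n assume "h \<in> max_power n"
    moreover from this have "k \<in> max_power n"
      using that order.trans[of "of_nat n" "max_order h"] by (simp add: mem_max_power_iff)
    ultimately show "of_nat n \<le> max_order (h \<oplus> k)" by (intro max_order_ge max_power_add)
  qed
  show "min (max_order f) (max_order g) \<le> max_order (f \<oplus> g)"
    using *[OF fg] *[OF fg(2,1)] a_comm[OF fg] by (simp add: min_def)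
  show "max_order (f \<otimes> g) = max_order f + max_order g"
    using fg(1)
  proof (cases rule: max_order_cases)
    case 1
    then have "f \<otimes> g \<in> max_power n" for n
      using max_power_mult[OF 1, of g 0 n] fg by simp
    then show ?thesis using 1 by (simp add: max_order_eq_top)
  next
    case f: (2 n)
    from fg(2) show ?thesis
    proof (cases rule: max_order_cases)
      case 1
      then have "f \<otimes> g \<in> max_power n" for n
        using max_power_mult[OF _ 1, of f 0 n] fg by simp
      then show ?thesis using 1 by (simp add: max_order_eq_top)
    next
      case g: (2 k)
      have "max_order (f \<otimes> g) = of_nat (n + k)"
        using max_power_mult[OF f(1) g(1)] max_power_mult_strict[OF f g] by (rule max_order_eq)
      then show ?thesis using f g by (simp add: max_order_eq)
    qed
  qed
next
  show "max_order \<zero> = \<infinity>" by (intro max_order_eq_top max_power_zero)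
  have "max_order \<one> = of_nat 0"
    by (rule max_order_eq) (simp_all add: max_power_1 one_not_mem_maximal)
  then show "max_order \<one> = 0" by simp
  fix f assume "f \<in> \<mm>"
  then have "(1::ennreal) \<le> max_order f" using max_order_ge[of f "Suc 0"] by (simp add: max_power_1)
  then show "0 < max_order f" by (rule order.strict_trans2[rotated]) simp
qed

text \<open>A normalized valuation is at least 1 at \<open>x\<close> and \<open>y\<close>, hence at
  least \<open>n\<close> on the \<open>n\<close>-th power of \<open>\<mm>\<close>. This makes the
  order a common lower bound of any two elements of the poset.\<close>

lemma max_order_le_normalized:
  assumes \<nu>: "\<nu> \<in> carrier (valuation_poset R \<mm>)" and "f \<in> carrier R"
  shows "max_order f \<le> \<nu> f"
proof -
  have c: "centered_valuation R \<mm> \<nu>" using \<nu> by (simp add: valuation_carrier_iff)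
  have "of_nat n \<le> \<nu> g" if "g \<in> max_power n" for g n
    using that
  proof (induction n arbitrary: g)
    case (Suc n)
    obtain a b where ab: "a \<in> max_power n" "b \<in> max_power n" "g = x \<otimes> a \<oplus> y \<otimes> b"
      using Suc.prems by (rule max_power_SucE)
    note [simp] = ab(1,2)[THEN max_power_closed]
    have "of_nat (Suc n) \<le> min (\<nu> x + \<nu> a) (\<nu> y + \<nu> b)"
      using normalized_ge_one[OF \<nu> x_mem] normalized_ge_one[OF \<nu> y_mem] ab(1,2)[THEN Suc.IH]
      by (auto intro: add_mono)
    also have "\<dots> \<le> \<nu> g"
      unfolding ab(3) using valuation_add[OF c, of "x \<otimes> a" "y \<otimes> b"] by (simp add: valuation_mult[OF c])
    finally show ?case .
  qed simp
  then show ?thesis by (rule max_order_le[OF assms(2)])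
qed

lemma max_order_mem_valuation_poset:
  assumes "\<nu> \<in> carrier (valuation_poset R \<mm>)"
  shows "max_order \<in> carrier (valuation_poset R \<mm>)"
proof (rule valuation_poset_carrierI[OF centered_valuation_max_order assms])
  show "max_order f \<le> \<nu> f" if "f \<in> carrier R" for f
    using assms that by (rule max_order_le_normalized)
  show "1 \<le> max_order f" if "f \<in> \<mm>" for f
    using max_order_ge[of f "Suc 0"] that by (simp add: max_power_1)
qed

end

text \<open>Given two members of the chain, the larger bounds both, so the values at
  \<open>f\<close> and at \<open>g\<close> can be approximated by one member. Additivity and the
  inequality for sums thus pass to the supremum. The bound \<open>\<mu>\<close> keeps it
  normalized.\<close>

lemma (in noetherian_local_ring) Sup_of_chain:
  assumes "L \<noteq> {}" and L: "L \<subseteq> carrier (valuation_poset R \<mm>)"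
    and chain: "\<And>\<kappa> \<rho>. \<lbrakk>\<kappa> \<in> L; \<rho> \<in> L\<rbrakk> \<Longrightarrow>
      (\<forall>f\<in>carrier R. \<kappa> f \<le> \<rho> f) \<or> (\<forall>f\<in>carrier R. \<rho> f \<le> \<kappa> f)"
    and \<mu>: "\<mu> \<in> carrier (valuation_poset R \<mm>)"
    and bound: "\<And>\<kappa> f. \<lbrakk>\<kappa> \<in> L; f \<in> carrier R\<rbrakk> \<Longrightarrow> \<kappa> f \<le> \<mu> f"
  shows "restrict (\<lambda>f. SUP \<kappa>\<in>L. \<kappa> f) (carrier R) \<in> carrier (valuation_poset R \<mm>)" (is "?S \<in> _")
proof (rule valuation_poset_carrierI[OF _ \<mu>])
  have c: "centered_valuation R \<mm> \<kappa>" if "\<kappa> \<in> L" for \<kappa>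
    using that L by (auto simp: valuation_carrier_iff)
  obtain \<kappa>0 where \<kappa>0: "\<kappa>0 \<in> L" using assms(1) by blast
  show ge_one: "1 \<le> ?S f" if "f \<in> \<mm>" for f
    using that \<kappa>0 L normalized_ge_one[of \<kappa>0 f] \<mm>.a_Hcarr by (auto intro!: SUP_upper2[of \<kappa>0])
  show "?S f \<le> \<mu> f" if "f \<in> carrier R" for f
    using that bound by (auto intro: SUP_least)
  show "centered_valuation R \<mm> ?S"
    unfolding centered_valuation_def
  proof (intro conjI ballI)
    fix f g assume fg: "f \<in> carrier R" "g \<in> carrier R"
    have dir: "\<exists>\<tau>\<in>L. \<kappa> f \<le> \<tau> f \<and> \<rho> g \<le> \<tau> g" if "\<kappa> \<in> L" "\<rho> \<in> L" for \<kappa> \<rho>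
      using chain[OF that] that fg by (elim disjE) (auto intro: bexI[of _ \<kappa>] bexI[of _ \<rho>])
    show "?S (f \<otimes> g) = ?S f + ?S g"
    proof -
      have "(SUP \<kappa>\<in>L. \<kappa> (f \<otimes> g)) = (SUP \<kappa>\<in>L. \<kappa> f + \<kappa> g)"
        using c fg by (intro SUP_cong) (auto simp: valuation_mult)
      also have "\<dots> = (SUP \<kappa>\<in>L. \<kappa> f) + (SUP \<kappa>\<in>L. \<kappa> g)"
        by (rule SUP_add_directed_ennreal) (use dir in \<open>blast intro: add_mono\<close>)
      finally show ?thesis using fg by simp
    qed
    show "min (?S f) (?S g) \<le> ?S (f \<oplus> g)"
    proof (rule ccontr)
      assume "\<not> ?thesis"
      then have "?S (f \<oplus> g) < ?S f" "?S (f \<oplus> g) < ?S g"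
        by (simp_all only: not_le min_less_iff_conj)
      then obtain \<kappa> \<rho> where \<kappa>\<rho>: "\<kappa> \<in> L" "\<rho> \<in> L" "?S (f \<oplus> g) < \<kappa> f" "?S (f \<oplus> g) < \<rho> g"
        using fg by (auto simp: less_SUP_iff)
      then obtain \<tau> where \<tau>: "\<tau> \<in> L" "\<kappa> f \<le> \<tau> f" "\<rho> g \<le> \<tau> g" using dir by blast
      have "?S (f \<oplus> g) < min (\<tau> f) (\<tau> g)" using \<kappa>\<rho> \<tau> by auto
      also have "\<dots> \<le> \<tau> (f \<oplus> g)" by (rule valuation_add[OF c[OF \<tau>(1)] fg])
      also have "\<dots> \<le> ?S (f \<oplus> g)" using \<tau>(1) fg by (auto intro: SUP_upper)
      finally show False by simp
    qed
  next
    have "\<infinity> \<le> (SUP \<kappa>\<in>L. \<kappa> \<zero>)"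
      using valuation_zero[OF c[OF \<kappa>0]] SUP_upper[OF \<kappa>0, of "\<lambda>\<kappa>. \<kappa> \<zero>"] by simp
    then show "?S \<zero> = \<infinity>" by (simp add: top_unique)
    have "(SUP \<kappa>\<in>L. \<kappa> \<one>) = (SUP \<kappa>\<in>L. 0)" by (intro SUP_cong) (auto simp: valuation_one c)
    then show "?S \<one> = 0" using assms(1) by simp
    fix f assume "f \<in> \<mm>"
    from ge_one[OF this] show "0 < ?S f" by (rule order.strict_trans2[rotated]) simp
  qed simp
qed

section \<open>Regular parameters from a chain of primes, and the infimum\<close>

lemma (in two_generated_local_ring) exists_prime_chain:
  assumes dim: "krull_dim R = 2"
  obtains P0 P1 where "primeideal P0 R" "primeideal P1 R" "P0 \<subset> P1" "x \<notin> P1 \<or> y \<notin> P1"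
proof -
  let ?C = "{enat n | n. \<exists>P :: nat \<Rightarrow> 'a set. (\<forall>i\<le>n. primeideal (P i) R) \<and> (\<forall>i<n. P i \<subset> P (Suc i))}"
  \<comment> \<open>A supremum strictly above 1 has a member \<open>n \<ge> 2\<close>; only the
    first three primes of its chain are kept.\<close>
  have "1 < Sup ?C" using dim by (simp add: krull_dim_def)
  then obtain n P where n: "1 < enat n" and P: "\<forall>i\<le>n. primeideal (P i) R" "\<forall>i<n. P i \<subset> P (Suc i)"
    by (auto simp: less_Sup_iff)
  from n have "2 \<le> n" by (simp add: one_enat_def)
  then have primes: "primeideal (P 0) R" "primeideal (P 1) R" "primeideal (P 2) R"
    and chain: "P 0 \<subset> P 1" "P 1 \<subset> P 2"
    using P(1)[rule_format, of 0] P(1)[rule_format, of 1] P(1)[rule_format, of 2]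
      P(2)[rule_format, of 0] P(2)[rule_format, of 1] by (auto simp: numeral_2_eq_2)
  interpret P1: primeideal "P 1" R by (rule primes)
  interpret P2: primeideal "P 2" R by (rule primes)
  have "P 2 \<subseteq> \<mm>" by (rule proper_ideal_subset_maximal[OF P2.is_ideal]) (use P2.I_notcarr in auto)
  \<comment> \<open>The middle prime is properly contained in \<open>P 2 \<subseteq> \<mm>\<close>,
    so it misses one of the generators of \<open>\<mm>\<close>.\<close>
  then have "\<not> \<mm> \<subseteq> P 1" using chain by blast
  then have "\<not> {x, y} \<subseteq> P 1" unfolding maximal_eq using genideal_minimal[OF P1.is_ideal] by blast
  then show ?thesis using that[OF primes(1,2) chain(1)] by blast
qed

lemma (in two_generated_local_ring) regular_parametersI:
  assumes "primeideal P0 R" "primeideal P1 R" "P0 \<subset> P1" "x \<notin> P1"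
  shows "regular_parameters R \<mm> x y"
proof -
  interpret domain R by (rule regular_sequence_if_prime_chain(1)[OF assms])
  interpret P1: primeideal P1 R by fact
  show ?thesis
  proof
    show "x \<noteq> \<zero>" using assms(4) P1.zero_closed by auto
    show "\<not> x divides y [^] n" for n :: nat
      by (rule regular_sequence_if_prime_chain(2)[OF assms])
  qed
qed

text \<open>Regularity provides two generators of \<open>\<mm>\<close>. One that lies outside the
  middle prime of the chain is taken as the first parameter.\<close>

lemma (in regular_local_ring) exists_regular_parameters:
  assumes dim: "krull_dim R = 2"
  obtains x y where "regular_parameters R \<mm> x y"
proof -
  obtain A where A: "A \<subseteq> carrier R" "finite A" "enat (card A) = krull_dim R" "\<mm> = Idl A"
    using regular by blast
  have "card A = 2" using A(3) dim by (simp add: numeral_eq_enat)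
  then obtain x y where xy: "A = {x, y}" by (auto simp: card_2_iff)
  interpret two_generated_local_ring R \<mm> x y
    by unfold_locales (use A xy in auto)
  interpret S: two_generated_local_ring R \<mm> y x by (rule swap_generators)
  show ?thesis
    using exists_prime_chain[OF dim] regular_parametersI S.regular_parametersI that by metis
qed

theorem theorem5p8:
  fixes R :: "('a, 'b) ring_scheme" and \<mm> :: "'a set" and \<mu> \<nu> :: "'a \<Rightarrow> ennreal"
  assumes "regular_local_ring R \<mm>"
    and "krull_dim R = 2"
    and "\<mu> \<in> carrier (valuation_poset R \<mm>)"
    and "\<nu> \<in> carrier (valuation_poset R \<mm>)"
  shows "\<exists>\<kappa>. greatest (valuation_poset R \<mm>) \<kappa> (Lower (valuation_poset R \<mm>) {\<mu>, \<nu>})"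
proof -
  interpret regular_local_ring R \<mm> by fact
  obtain x y where "regular_parameters R \<mm> x y" using exists_regular_parameters[OF assms(2)] .
  then interpret regular_parameters R \<mm> x y .
  let ?V = "valuation_poset R \<mm>"
  define L where "L = Lower ?V {\<mu>, \<nu>}"
  have L_iff: "\<kappa> \<in> L \<longleftrightarrow> \<kappa> \<in> carrier ?V \<and> (\<forall>f\<in>carrier R. \<kappa> f \<le> \<mu> f \<and> \<kappa> f \<le> \<nu> f)" for \<kappa>
    using assms(3,4) by (auto simp: L_def Lower_def)
  define S where "S = restrict (\<lambda>f. SUP \<kappa>\<in>L. \<kappa> f) (carrier R)"
  have "max_order \<in> L"
    using max_order_mem_valuation_poset max_order_le_normalized assms(3,4) by (simp add: L_iff)
  then have "L \<noteq> {}" by blast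
  \<comment> \<open>All members of \<open>L\<close> lie below \<open>\<mu>\<close>, which makes
    \<open>L\<close> a chain and bounds its supremum.\<close>
  then have "S \<in> carrier ?V"
    unfolding S_def
    by (intro Sup_of_chain[OF _ _ _ assms(3)] lower_bounds_comparable[OF _ _ assms(3)])
      (auto simp: L_iff)
  moreover have "S f \<le> \<mu> f \<and> S f \<le> \<nu> f" if "f \<in> carrier R" for f
    using that by (auto simp: S_def L_iff intro!: SUP_least)
  ultimately have "S \<in> L" by (simp add: L_iff)
  moreover have "\<kappa> f \<le> S f" if "\<kappa> \<in> L" "f \<in> carrier R" for \<kappa> f
    using that by (auto simp: S_def intro: SUP_upper)
  ultimately have "greatest ?V S L"
    by (auto simp: greatest_def L_iff)
  then show ?thesis unfolding L_def by blast
qed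

end
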